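(* Let $X_1\leftarrow X_2\leftarrow X_3\leftarrow\cdots$ be a sequence of regular finite coverings of connected manifolds, where $X_1$ (hence each $X_k$) is a closed Riemannian manifold and each $X_k$ carries the pulled-back metric, and let $X_\infty$ be the associated covering solenoid. For each $k\in\mathbb N$ let $A_k\subset L^2(X_k)$ be an orthonormal collection of eigenfunctions of the Laplacian $\Delta_{X_k}$ whose algebraic span is dense in $L^2(X_k)$, chosen so that $P_{k+1,k}^*(A_k)\subset A_{k+1}$ for every $k$. Let $\mathcal A$ be the set of all finite complex linear combinations of elements of $\bigcup_kP_{\infty,k}^*(A_k)$. Then the closure of $\mathcal A$ in the $L^2(X_\infty)$ norm satisfies $\overline{\mathcal A}=L^2(X_\infty)$.
   Context: Setting. $X_1\leftarrow X_2\leftarrow X_3\leftarrow\cdots$ is a sequence of finite coverings of connected smooth manifolds. For $j>i$, $P_{j,i}:X_j\to X_i$ denotes the resulting covering map, and every $P_{j,i}$ is a regular (normal) finite covering. Closed means compact without boundary. $X_1$ has a Riemannian metric $g$ and each $X_i$ has the metric $P_{i,1}^*g$; $\Delta_{X_k}$ is the Laplacian of $X_k$. Solenoid. $X_\infty=\{(x_1,x_2,\dots)\in\prod X_i : P_{j,i}(x_j)=x_i \text{ for all } j>i\}$ with the subspace topology from the product; $P_{\infty,i}:X_\infty\to X_i$ is the projection. Let $G_i=\pi_1(X_i)$, regarded as a finite-index normal subgroup of $G_1$ via $P_{i,1}$, so that $G_1/G_i$ is the deck group of $P_{i,1}$, and let $G_\infty=\varprojlim G_1/G_i$ (a compact group).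 Then $P_{\infty,1}:X_\infty\to X_1$ is a principal $G_\infty$-bundle. Measures. $\mu_1$ is the Riemannian volume measure of $X_1$. $\mu_i$ is the measure on $X_i$ given by $\mu_i(E)=\int_{X_1}\frac{\#(E\cap P_{i,1}^{-1}(x))}{[G_1:G_i]}\,d\mu_1(x)$. $\mu_\infty$ is the measure on $X_\infty$ given by $\mu_\infty(Z)=\int_{X_1}\nu_x(Z\cap P_{\infty,1}^{-1}(x))\,d\mu_1(x)$, where $\nu_x$ is the push-forward to the fiber $P_{\infty,1}^{-1}(x)$ of the Haar measure of total mass $1$ on $G_\infty$ (by an orbit map). $L^2(X_i)$ and $L^2(X_\infty)$ are complex $L^2$-spaces for $\mu_i$ and $\mu_\infty$. Pullback is $P_{\infty,k}^*(h)=h\circ P_{\infty,k}$; it maps $L^2(X_k)$ isometrically into $L^2(X_\infty)$. *)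

theory Defs
  imports
    "HOL-Probability.Probability"
    "HOL-Algebra.Product_Groups"
    "HOL-Algebra.Bij"
    "HOL-Algebra.Coset"
    "Jordan_Normal_Form.Determinant"
    "Jordan_Normal_Form.Gauss_Jordan_Elimination"
begin

section \<open>Calculus on coordinate space\<close>

text \<open>Points of \<open>n\<close>-dimensional coordinate space are extensional functions on \<open>{..<n}\<close>, so
  that \<open>n = 0\<close> is allowed and the topology and Lebesgue measure are the library products.\<close>

abbreviation coord_space :: "nat \<Rightarrow> (nat \<Rightarrow> real) topology" where
  "coord_space n \<equiv> product_topology (\<lambda>_. euclideanreal) {..<n}"

abbreviation coord_lebesgue :: "nat \<Rightarrow> (nat \<Rightarrow> real) measure" where
  "coord_lebesgue n \<equiv> Pi\<^sub>M {..<n} (\<lambda>_. lborel)"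

definition partial ::
  "nat \<Rightarrow> ((nat \<Rightarrow> real) \<Rightarrow> 'b::real_normed_vector) \<Rightarrow> (nat \<Rightarrow> real) \<Rightarrow> 'b" where
  "partial i F z = vector_derivative (\<lambda>t. F (z(i := t))) (at (z i))"

text \<open>The following are only used for \<open>V\<close> open in \<open>coord_space n\<close>.\<close>

primrec Ck_on ::
  "nat \<Rightarrow> nat \<Rightarrow> (nat \<Rightarrow> real) set \<Rightarrow> ((nat \<Rightarrow> real) \<Rightarrow> 'b::real_normed_vector) \<Rightarrow> bool" where
  "Ck_on n 0 V F \<longleftrightarrow> continuous_map (subtopology (coord_space n) V) euclidean F"
| "Ck_on n (Suc k) V F \<longleftrightarrow>
     continuous_map (subtopology (coord_space n) V) euclidean F \<and>
     (\<forall>i<n. (\<forall>z\<in>V. (\<lambda>t. F (z(i := t))) differentiable (at (z i))) \<and> Ck_on n k V (partial i F))"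

definition smooth_coord ::
  "nat \<Rightarrow> (nat \<Rightarrow> real) set \<Rightarrow> ((nat \<Rightarrow> real) \<Rightarrow> 'b::real_normed_vector) \<Rightarrow> bool" where
  "smooth_coord n V F \<longleftrightarrow> (\<forall>k. Ck_on n k V F)"


section \<open>Smooth manifolds and smooth maps\<close>

type_synonym 'a chart = "'a set \<times> ('a \<Rightarrow> nat \<Rightarrow> real)"

record 'a smooth_space =
  mtop :: "'a topology"
  atlas :: "'a chart set"

abbreviation points :: "'a smooth_space \<Rightarrow> 'a set" where
  "points M \<equiv> topspace (mtop M)"

abbreviation chart_inv :: "'a chart \<Rightarrow> (nat \<Rightarrow> real) \<Rightarrow> 'a" where
  "chart_inv c \<equiv> inv_into (fst c) (snd c)"

abbreviation chart_image :: "'a chart \<Rightarrow> (nat \<Rightarrow> real) set" where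
  "chart_image c \<equiv> snd c ` fst c"

definition is_chart :: "nat \<Rightarrow> 'a topology \<Rightarrow> 'a chart \<Rightarrow> bool" where
  "is_chart n X c \<longleftrightarrow> openin X (fst c) \<and> openin (coord_space n) (chart_image c) \<and>
     homeomorphic_map (subtopology X (fst c)) (subtopology (coord_space n) (chart_image c)) (snd c)"

definition second_countable_space :: "'a topology \<Rightarrow> bool" where
  "second_countable_space X \<longleftrightarrow>
     (\<exists>\<B>. countable \<B> \<and> (\<forall>V\<in>\<B>. openin X V) \<and>
          (\<forall>U x. openin X U \<and> x \<in> U \<longrightarrow> (\<exists>V\<in>\<B>. x \<in> V \<and> V \<subseteq> U)))"

text \<open>Charts take values in open subsets of coordinate space, so manifolds have no boundary.\<close>

definition smooth_manifold :: "nat \<Rightarrow> 'a smooth_space \<Rightarrow> bool" where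
  "smooth_manifold n M \<longleftrightarrow>
     Hausdorff_space (mtop M) \<and> second_countable_space (mtop M) \<and>
     (\<forall>c\<in>atlas M. is_chart n (mtop M) c) \<and>
     (\<Union>c\<in>atlas M. fst c) = points M \<and>
     (\<forall>c\<in>atlas M. \<forall>d\<in>atlas M. \<forall>j<n.
        smooth_coord n (snd c ` (fst c \<inter> fst d)) (\<lambda>z. snd d (chart_inv c z) j))"

definition smooth_function ::
  "nat \<Rightarrow> 'a smooth_space \<Rightarrow> ('a \<Rightarrow> 'b::real_normed_vector) \<Rightarrow> bool" where
  "smooth_function n M f \<longleftrightarrow> (\<forall>c\<in>atlas M. smooth_coord n (chart_image c) (f \<circ> chart_inv c))"

definition smooth_map_on ::
  "nat \<Rightarrow> 'a smooth_space \<Rightarrow> 'a set \<Rightarrow> 'b smooth_space \<Rightarrow> ('a \<Rightarrow> 'b) \<Rightarrow> bool" where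
  "smooth_map_on n M V N f \<longleftrightarrow>
     continuous_map (subtopology (mtop M) V) (mtop N) f \<and>
     (\<forall>c\<in>atlas M. \<forall>d\<in>atlas N. \<forall>j<n.
        smooth_coord n (snd c ` (fst c \<inter> V \<inter> f -` fst d)) (\<lambda>z. snd d (f (chart_inv c z)) j))"

definition diffeomorphism_on ::
  "nat \<Rightarrow> 'a smooth_space \<Rightarrow> 'a set \<Rightarrow> 'b smooth_space \<Rightarrow> 'b set \<Rightarrow> ('a \<Rightarrow> 'b) \<Rightarrow> bool" where
  "diffeomorphism_on n M V N U f \<longleftrightarrow>
     bij_betw f V U \<and> smooth_map_on n M V N f \<and> smooth_map_on n N U M (inv_into V f)"


section \<open>Coverings\<close>

definition smooth_covering ::
  "nat \<Rightarrow> 'a smooth_space \<Rightarrow> 'b smooth_space \<Rightarrow> ('a \<Rightarrow> 'b) \<Rightarrow> bool" where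
  "smooth_covering n M N p \<longleftrightarrow>
     smooth_map_on n M (points M) N p \<and> p ` points M = points N \<and>
     (\<forall>y\<in>points N. \<exists>U. openin (mtop N) U \<and> y \<in> U \<and>
        (\<exists>\<V>. \<Union>\<V> = {x \<in> points M. p x \<in> U} \<and> pairwise disjnt \<V> \<and>
             (\<forall>V\<in>\<V>. openin (mtop M) V \<and> diffeomorphism_on n M V N U p)))"

definition fibre :: "'a topology \<Rightarrow> ('a \<Rightarrow> 'b) \<Rightarrow> 'b \<Rightarrow> 'a set" where
  "fibre X p y = {x \<in> topspace X. p x = y}"

definition deck_group :: "'a topology \<Rightarrow> ('a \<Rightarrow> 'b) \<Rightarrow> ('a \<Rightarrow> 'a) monoid" where
  "deck_group X p = BijGroup (topspace X)
     \<lparr>carrier := {h \<in> Bij (topspace X). homeomorphic_map X X h \<and> (\<forall>x\<in>topspace X. p (h x) = p x)}\<rparr>"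

text \<open>Regular coverings are those whose deck group acts transitively on the fibres.\<close>

definition regular_finite_covering ::
  "nat \<Rightarrow> 'a smooth_space \<Rightarrow> 'b smooth_space \<Rightarrow> ('a \<Rightarrow> 'b) \<Rightarrow> bool" where
  "regular_finite_covering n M N p \<longleftrightarrow>
     smooth_covering n M N p \<and>
     (\<forall>y\<in>points N. finite (fibre (mtop M) p y)) \<and>
     (\<forall>x\<in>points M. \<forall>x'\<in>points M. p x = p x' \<longrightarrow>
        (\<exists>h\<in>carrier (deck_group (mtop M) p). h x = x'))"

text \<open>\<open>tower_map p j i\<close> is the composite \<open>P\<^bsub>j,i\<^esub> : X\<^sub>j \<rightarrow> X\<^sub>i\<close> (for \<open>i \<le> j\<close>) of the one-step maps
  \<open>p k : X\<^bsub>k+1\<^esub> \<rightarrow> X\<^sub>k\<close>.  Towers are indexed from \<open>0\<close>.\<close>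

primrec tower_map :: "(nat \<Rightarrow> 'a \<Rightarrow> 'a) \<Rightarrow> nat \<Rightarrow> nat \<Rightarrow> 'a \<Rightarrow> 'a" where
  "tower_map p 0 i = id"
| "tower_map p (Suc j) i = (if i \<le> j then tower_map p j i \<circ> p j else id)"


section \<open>Riemannian geometry\<close>

text \<open>Tangent vectors are derivations at \<open>x\<close> of the algebra of real smooth functions, extended by
  zero to all other functions.  A derivation does not see the values of a function outside
  the manifold: a function vanishing on \<open>points M\<close> is its own product with the smooth function
  \<open>indicator (- points M)\<close>.\<close>

definition tangent_space :: "nat \<Rightarrow> 'a smooth_space \<Rightarrow> 'a \<Rightarrow> (('a \<Rightarrow> real) \<Rightarrow> real) set" where
  "tangent_space n M x = {v.
     (\<forall>f. \<not> smooth_function n M f \<longrightarrow> v f = 0) \<and>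
     (\<forall>f h a b. smooth_function n M f \<and> smooth_function n M h \<longrightarrow>
        v (\<lambda>y. a * f y + b * h y) = a * v f + b * v h) \<and>
     (\<forall>f h. smooth_function n M f \<and> smooth_function n M h \<longrightarrow>
        v (\<lambda>y. f y * h y) = f x * v h + h x * v f)}"

definition coord_vector ::
  "nat \<Rightarrow> 'a smooth_space \<Rightarrow> 'a chart \<Rightarrow> nat \<Rightarrow> 'a \<Rightarrow> ('a \<Rightarrow> real) \<Rightarrow> real" where
  "coord_vector n M c i x f =
     (if smooth_function n M f then partial i (f \<circ> chart_inv c) (snd c x) else 0)"

definition push_vector ::
  "nat \<Rightarrow> 'b smooth_space \<Rightarrow> ('a \<Rightarrow> 'b) \<Rightarrow> (('a \<Rightarrow> real) \<Rightarrow> real) \<Rightarrow> ('b \<Rightarrow> real) \<Rightarrow> real" where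
  "push_vector n N p v f = (if smooth_function n N f then v (f \<circ> p) else 0)"

type_synonym 'a metric_tensor =
  "'a \<Rightarrow> (('a \<Rightarrow> real) \<Rightarrow> real) \<Rightarrow> (('a \<Rightarrow> real) \<Rightarrow> real) \<Rightarrow> real"

definition metric_matrix ::
  "nat \<Rightarrow> 'a smooth_space \<Rightarrow> 'a metric_tensor \<Rightarrow> 'a chart \<Rightarrow> (nat \<Rightarrow> real) \<Rightarrow> real mat" where
  "metric_matrix n M g c z = mat n n (\<lambda>(i, j).
     g (chart_inv c z) (coord_vector n M c i (chart_inv c z)) (coord_vector n M c j (chart_inv c z)))"

definition riemannian_metric :: "nat \<Rightarrow> 'a smooth_space \<Rightarrow> 'a metric_tensor \<Rightarrow> bool" where
  "riemannian_metric n M g \<longleftrightarrow>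
     (\<forall>x\<in>points M. \<forall>u\<in>tangent_space n M x. \<forall>v\<in>tangent_space n M x.
        g x u v = g x v u \<and>
        (\<forall>w\<in>tangent_space n M x. \<forall>a b.
           g x (\<lambda>f. a * u f + b * v f) w = a * g x u w + b * g x v w) \<and>
        (u \<noteq> (\<lambda>_. 0) \<longrightarrow> g x u u > 0)) \<and>
     (\<forall>c\<in>atlas M. \<forall>i<n. \<forall>j<n.
        smooth_coord n (chart_image c) (\<lambda>z. metric_matrix n M g c z $$ (i, j)))"

definition pullback_metric ::
  "nat \<Rightarrow> 'b smooth_space \<Rightarrow> ('a \<Rightarrow> 'b) \<Rightarrow> 'b metric_tensor \<Rightarrow> 'a metric_tensor" where
  "pullback_metric n N p g x u v = g (p x) (push_vector n N p u) (push_vector n N p v)"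

definition volume_density ::
  "nat \<Rightarrow> 'a smooth_space \<Rightarrow> 'a metric_tensor \<Rightarrow> 'a chart \<Rightarrow> (nat \<Rightarrow> real) \<Rightarrow> real" where
  "volume_density n M g c z = sqrt (Determinant.det (metric_matrix n M g c z))"

text \<open>\<open>\<Delta> f = |g|\<^sup>-\<^sup>1\<^sup>/\<^sup>2 \<Sum>\<^sub>i \<partial>\<^sub>i (|g|\<^sup>1\<^sup>/\<^sup>2 \<Sum>\<^sub>j g\<^sup>i\<^sup>j \<partial>\<^sub>j f)\<close>.  The value does not depend on the chart
  selected; the opposite sign convention would give the same eigenfunctions.\<close>

definition laplacian ::
  "nat \<Rightarrow> 'a smooth_space \<Rightarrow> 'a metric_tensor \<Rightarrow> ('a \<Rightarrow> complex) \<Rightarrow> 'a \<Rightarrow> complex" where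
  "laplacian n M g f x =
     (let c = (SOME c. c \<in> atlas M \<and> x \<in> fst c);
          \<rho> = volume_density n M g c;
          ginv = (\<lambda>z. the (mat_inverse (metric_matrix n M g c z)))
      in (1 / \<rho> (snd c x)) *\<^sub>R
         (\<Sum>i<n. partial i
            (\<lambda>z. \<rho> z *\<^sub>R (\<Sum>j<n. (ginv z $$ (i, j)) *\<^sub>R partial j (f \<circ> chart_inv c) z))
            (snd c x)))"

text \<open>Functions on a space are represented by extensional functions, so that equality of
  representatives is equality of functions on that space.\<close>

definition laplace_eigenfunction ::
  "nat \<Rightarrow> 'a smooth_space \<Rightarrow> 'a metric_tensor \<Rightarrow> ('a \<Rightarrow> complex) \<Rightarrow> bool" where
  "laplace_eigenfunction n M g f \<longleftrightarrow>
     f \<in> extensional (points M) \<and> smooth_function n M f \<and> (\<exists>x\<in>points M. f x \<noteq> 0) \<and>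
     (\<exists>ev::complex. \<forall>x\<in>points M. laplacian n M g f x = ev * f x)"


section \<open>Measures\<close>

definition borel_on :: "'a topology \<Rightarrow> 'a measure" where
  "borel_on X = sigma (topspace X) {U. openin X U}"

definition riemannian_volume ::
  "nat \<Rightarrow> 'a smooth_space \<Rightarrow> 'a metric_tensor \<Rightarrow> 'a measure \<Rightarrow> bool" where
  "riemannian_volume n M g \<mu> \<longleftrightarrow>
     space \<mu> = points M \<and> sets \<mu> = sets (borel_on (mtop M)) \<and>
     (\<forall>c\<in>atlas M. \<forall>E\<in>sets (borel_on (mtop M)). E \<subseteq> fst c \<longrightarrow>
        emeasure \<mu> E =
          (\<integral>\<^sup>+z\<in>snd c ` E. ennreal (volume_density n M g c z) \<partial>coord_lebesgue n))"

text \<open>On a compact group the Haar measure of total mass \<open>1\<close>.  No regularity clause is needed for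
  the groups considered here, which are compact and metrizable.\<close>

definition haar_probability :: "('g, 'm) monoid_scheme \<Rightarrow> 'g topology \<Rightarrow> 'g measure \<Rightarrow> bool" where
  "haar_probability G T H \<longleftrightarrow>
     space H = carrier G \<and> sets H = sets (borel_on T) \<and> emeasure H (carrier G) = 1 \<and>
     (\<forall>a\<in>carrier G. \<forall>E\<in>sets H. emeasure H (a <#\<^bsub>G\<^esub> E) = emeasure H E)"


section \<open>The solenoid of a tower of coverings\<close>

definition solenoid :: "(nat \<Rightarrow> 'a topology) \<Rightarrow> (nat \<Rightarrow> 'a \<Rightarrow> 'a) \<Rightarrow> (nat \<Rightarrow> 'a) topology" where
  "solenoid X p = subtopology (product_topology X UNIV) {x. \<forall>i j. i < j \<longrightarrow> tower_map p j i (x j) = x i}"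

abbreviation level_deck_group ::
  "(nat \<Rightarrow> 'a topology) \<Rightarrow> (nat \<Rightarrow> 'a \<Rightarrow> 'a) \<Rightarrow> nat \<Rightarrow> ('a \<Rightarrow> 'a) monoid" where
  "level_deck_group X p i \<equiv> deck_group (X i) (tower_map p i 0)"

text \<open>With \<open>G\<^sub>1/G\<^sub>i\<close> the deck group of \<open>X\<^sub>i \<rightarrow> X\<^sub>1\<close>, the projection \<open>G\<^sub>1/G\<^sub>j \<rightarrow> G\<^sub>1/G\<^sub>i\<close> sends a deck
  transformation of \<open>X\<^sub>j\<close> to the one it covers on \<open>X\<^sub>i\<close>.\<close>

definition solenoid_group ::
  "(nat \<Rightarrow> 'a topology) \<Rightarrow> (nat \<Rightarrow> 'a \<Rightarrow> 'a) \<Rightarrow> (nat \<Rightarrow> 'a \<Rightarrow> 'a) monoid" where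
  "solenoid_group X p = product_group UNIV (level_deck_group X p)
     \<lparr>carrier := {h \<in> (\<Pi>\<^sub>E i\<in>UNIV. carrier (level_deck_group X p i)).
        \<forall>i j. i < j \<longrightarrow> (\<forall>x\<in>topspace (X j). tower_map p j i (h j x) = h i (tower_map p j i x))}\<rparr>"

definition solenoid_group_topology ::
  "(nat \<Rightarrow> 'a topology) \<Rightarrow> (nat \<Rightarrow> 'a \<Rightarrow> 'a) \<Rightarrow> (nat \<Rightarrow> 'a \<Rightarrow> 'a) topology" where
  "solenoid_group_topology X p =
     subtopology (product_topology (\<lambda>i. discrete_topology (carrier (level_deck_group X p i))) UNIV)
       (carrier (solenoid_group X p))"

definition level_measure ::
  "(nat \<Rightarrow> 'a topology) \<Rightarrow> (nat \<Rightarrow> 'a \<Rightarrow> 'a) \<Rightarrow> 'a measure \<Rightarrow> nat \<Rightarrow> 'a measure" where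
  "level_measure X p \<mu> i = measure_of (topspace (X i)) (sets (borel_on (X i)))
     (\<lambda>E. \<integral>\<^sup>+x. ennreal (real (card (E \<inter> fibre (X i) (tower_map p i 0) x))
                          / real (order (level_deck_group X p i))) \<partial>\<mu>)"

definition solenoid_fibre ::
  "(nat \<Rightarrow> 'a topology) \<Rightarrow> (nat \<Rightarrow> 'a \<Rightarrow> 'a) \<Rightarrow> 'a \<Rightarrow> (nat \<Rightarrow> 'a) set" where
  "solenoid_fibre X p x = fibre (solenoid X p) (\<lambda>z. z 0) x"

text \<open>The base point of the orbit map is irrelevant, Haar measure on a compact group being
  bi-invariant.\<close>

definition fibre_measure ::
  "(nat \<Rightarrow> 'a topology) \<Rightarrow> (nat \<Rightarrow> 'a \<Rightarrow> 'a) \<Rightarrow> (nat \<Rightarrow> 'a \<Rightarrow> 'a) measure \<Rightarrow> 'a \<Rightarrow> (nat \<Rightarrow> 'a) measure" where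
  "fibre_measure X p H x =
     (let b = (SOME b. b \<in> solenoid_fibre X p x)
      in distr H (borel_on (subtopology (solenoid X p) (solenoid_fibre X p x))) (\<lambda>h i. h i (b i)))"

definition solenoid_measure ::
  "(nat \<Rightarrow> 'a topology) \<Rightarrow> (nat \<Rightarrow> 'a \<Rightarrow> 'a) \<Rightarrow> 'a measure \<Rightarrow> (nat \<Rightarrow> 'a \<Rightarrow> 'a) measure
     \<Rightarrow> (nat \<Rightarrow> 'a) measure" where
  "solenoid_measure X p \<mu> H =
     measure_of (topspace (solenoid X p)) (sets (borel_on (solenoid X p)))
       (\<lambda>Z. \<integral>\<^sup>+x. emeasure (fibre_measure X p H x) (Z \<inter> solenoid_fibre X p x) \<partial>\<mu>)"


section \<open>Square-integrable functions\<close>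

text \<open>Elements of \<open>L\<^sup>2\<close> are represented by functions rather than by classes modulo null sets.
  An \<open>L\<^sup>2\<close>-closure is taken for the seminorm, so it is a union of such classes and the closure
  equals \<open>L2_space\<close> iff the corresponding closure of classes is the whole quotient space.\<close>

definition L2_space :: "'x measure \<Rightarrow> ('x \<Rightarrow> complex) set" where
  "L2_space \<mu> = {f \<in> borel_measurable \<mu>. integrable \<mu> (\<lambda>x. (cmod (f x))\<^sup>2)}"

definition L2_inner :: "'x measure \<Rightarrow> ('x \<Rightarrow> complex) \<Rightarrow> ('x \<Rightarrow> complex) \<Rightarrow> complex" where
  "L2_inner \<mu> f h = (\<integral>x. f x * cnj (h x) \<partial>\<mu>)"

definition L2_norm :: "'x measure \<Rightarrow> ('x \<Rightarrow> complex) \<Rightarrow> real" where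
  "L2_norm \<mu> f = sqrt (\<integral>x. (cmod (f x))\<^sup>2 \<partial>\<mu>)"

text \<open>Membership of the approximants in \<open>L2_space\<close> is required explicitly because the integral of
  a non-integrable function is \<open>0\<close>.\<close>

definition L2_closure :: "'x measure \<Rightarrow> ('x \<Rightarrow> complex) set \<Rightarrow> ('x \<Rightarrow> complex) set" where
  "L2_closure \<mu> S = {f \<in> L2_space \<mu>.
     \<forall>\<epsilon>>0. \<exists>h \<in> S \<inter> L2_space \<mu>. L2_norm \<mu> (\<lambda>x. f x - h x) < \<epsilon>}"

definition orthonormal_in :: "'x measure \<Rightarrow> ('x \<Rightarrow> complex) set \<Rightarrow> bool" where
  "orthonormal_in \<mu> S \<longleftrightarrow>
     S \<subseteq> L2_space \<mu> \<and> (\<forall>f\<in>S. \<forall>h\<in>S. L2_inner \<mu> f h = (if f = h then 1 else 0))"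

definition complex_span :: "('x \<Rightarrow> complex) set \<Rightarrow> ('x \<Rightarrow> complex) set" where
  "complex_span S = {\<lambda>x. \<Sum>f\<in>F. a f * f x | F a. finite F \<and> F \<subseteq> S}"

abbreviation level_pullback ::
  "(nat \<Rightarrow> 'a topology) \<Rightarrow> (nat \<Rightarrow> 'a \<Rightarrow> 'a) \<Rightarrow> nat \<Rightarrow> ('a \<Rightarrow> complex) \<Rightarrow> 'a \<Rightarrow> complex" where
  "level_pullback X p k f \<equiv> compose (topspace (X (Suc k))) f (p k)"

abbreviation solenoid_pullback ::
  "(nat \<Rightarrow> 'a topology) \<Rightarrow> (nat \<Rightarrow> 'a \<Rightarrow> 'a) \<Rightarrow> nat \<Rightarrow> ('a \<Rightarrow> complex) \<Rightarrow> (nat \<Rightarrow> 'a) \<Rightarrow> complex" where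
  "solenoid_pullback X p k f \<equiv> compose (topspace (solenoid X p)) f (\<lambda>x. x k)"

end

theory Submission
  imports Defs
begin

text \<open>
  Every open subset of the solenoid is a countable union of cylinders \<open>P\<^bsub>\<infinity>,k\<^esub>\<^sup>-\<^sup>1(U)\<close>, so the
  cylinders over Borel sets form a \<open>\<pi>\<close>-system generating the Borel sets, and it suffices to
  approximate their indicators.  That is done on the level \<open>X\<^sub>k\<close> and transported along
  \<open>P\<^bsub>\<infinity>,k\<^esub>\<close>, an isometry on \<open>L\<^sup>2\<close> because \<open>\<mu>\<^sub>\<infinity>\<close> pushes forward to \<open>\<mu>\<^sub>k\<close>.  The latter comes from
  invariance of Haar measure: by uniqueness of lifts the group of the solenoid acts transitively
  on its fibres, so each deck transformation of \<open>X\<^sub>k\<close> is the \<open>k\<close>-th component of a set of Haar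
  measure \<open>1/[G\<^sub>1:G\<^sub>k]\<close>.
\<close>

section \<open>Square-integrable functions\<close>

text \<open>Two facts allow the reduction to a single level. A basic open box of the product
  restrains finitely many coordinates, and along a thread each of these is a function of the highest
  one. There are only countably many levels, so possibly uncountable unions of boxes are formed
  inside the levels, where unions of open sets are open. Indicators are square integrable because
  the total mass is finite. The Riemannian volume is specified only through its values inside
  charts, so this finiteness is drawn from compactness and from continuity of the density. On the
  fibres, the index [G_1:G_k] has to count the points of X_k over a point of X_1. Connectedness
  makes the deck action free and regularity makes it transitive, so the points of such a fibre and
  the events h_k = d are indexed by the same finite group.\<close>

lemma L2_space_combine:
  assumes "f \<in> L2_space \<mu>" "h \<in> L2_space \<mu>"
  shows "(\<lambda>x. a * f x + b * h x) \<in> L2_space \<mu>"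
proof -
  have [measurable]: "f \<in> borel_measurable \<mu>" "h \<in> borel_measurable \<mu>"
    and i: "integrable \<mu> (\<lambda>x. (cmod (f x))\<^sup>2)" "integrable \<mu> (\<lambda>x. (cmod (h x))\<^sup>2)"
    using assms by (auto simp: L2_space_def)
  have bound: "(cmod (a * f x + b * h x))\<^sup>2 \<le> 2 * (cmod a)\<^sup>2 * (cmod (f x))\<^sup>2 + 2 * (cmod b)\<^sup>2 * (cmod (h x))\<^sup>2"
    for x
  proof -
    have "(cmod (a * f x + b * h x))\<^sup>2 \<le> (cmod (a * f x) + cmod (b * h x))\<^sup>2"
      by (intro power_mono norm_triangle_ineq) auto
    also have "\<dots> \<le> 2 * (cmod (a * f x))\<^sup>2 + 2 * (cmod (b * h x))\<^sup>2"
      using sum_squares_bound[of "cmod (a * f x)" "cmod (b * h x)"] by (simp add: power2_sum)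
    finally show ?thesis by (simp add: norm_mult power_mult_distrib)
  qed
  have "integrable \<mu> (\<lambda>x. (cmod (a * f x + b * h x))\<^sup>2)"
  proof (rule Bochner_Integration.integrable_bound)
    show "integrable \<mu> (\<lambda>x. 2 * (cmod a)\<^sup>2 * (cmod (f x))\<^sup>2 + 2 * (cmod b)\<^sup>2 * (cmod (h x))\<^sup>2)"
      using i by auto
    show "AE x in \<mu>. norm ((cmod (a * f x + b * h x))\<^sup>2)
        \<le> norm (2 * (cmod a)\<^sup>2 * (cmod (f x))\<^sup>2 + 2 * (cmod b)\<^sup>2 * (cmod (h x))\<^sup>2)"
      using bound by (auto intro: order_trans)
  qed measurable
  then show ?thesis by (auto simp: L2_space_def)
qed

lemma L2_space_cong:
  assumes "\<And>x. x \<in> space \<nu> \<Longrightarrow> f x = h x"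
  shows "f \<in> L2_space \<nu> \<longleftrightarrow> h \<in> L2_space \<nu>"
  unfolding L2_space_def using assms
  by (auto cong: measurable_cong Bochner_Integration.integrable_cong)

lemma zero_in_L2_space: "(\<lambda>x. 0) \<in> L2_space \<mu>"
  by (simp add: L2_space_def)

lemma L2_space_diff: "f \<in> L2_space \<mu> \<Longrightarrow> h \<in> L2_space \<mu> \<Longrightarrow> (\<lambda>x. f x - h x) \<in> L2_space \<mu>"
  using L2_space_combine[of f \<mu> h 1 "-1"] by simp

lemma L2_space_add: "f \<in> L2_space \<mu> \<Longrightarrow> h \<in> L2_space \<mu> \<Longrightarrow> (\<lambda>x. f x + h x) \<in> L2_space \<mu>"
  using L2_space_combine[of f \<mu> h 1 1] by simp

lemma L2_space_scale: "f \<in> L2_space \<mu> \<Longrightarrow> (\<lambda>x. a * f x) \<in> L2_space \<mu>"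
  using L2_space_combine[of f \<mu> f a 0] by simp

text \<open>The factor \<open>2\<close> is harmless for density and makes Minkowski's inequality unnecessary.\<close>

lemma L2_norm_add_le:
  assumes "f \<in> L2_space \<mu>" "h \<in> L2_space \<mu>"
  shows "L2_norm \<mu> (\<lambda>x. f x + h x) \<le> 2 * (L2_norm \<mu> f + L2_norm \<mu> h)"
proof -
  let ?I = "\<lambda>f. \<integral>x. (cmod (f x))\<^sup>2 \<partial>\<mu>"
  have i: "integrable \<mu> (\<lambda>x. (cmod (f x))\<^sup>2)" "integrable \<mu> (\<lambda>x. (cmod (h x))\<^sup>2)"
    "integrable \<mu> (\<lambda>x. (cmod (f x + h x))\<^sup>2)"
    using assms L2_space_add[OF assms] by (auto simp: L2_space_def)
  have bound: "(cmod (f x + h x))\<^sup>2 \<le> 2 * (cmod (f x))\<^sup>2 + 2 * (cmod (h x))\<^sup>2" for x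
  proof -
    have "(cmod (f x + h x))\<^sup>2 \<le> (cmod (f x) + cmod (h x))\<^sup>2"
      by (intro power_mono norm_triangle_ineq) auto
    also have "\<dots> \<le> 2 * (cmod (f x))\<^sup>2 + 2 * (cmod (h x))\<^sup>2"
      using sum_squares_bound[of "cmod (f x)" "cmod (h x)"] by (simp add: power2_sum)
    finally show ?thesis .
  qed
  have "?I (\<lambda>x. f x + h x) \<le> (\<integral>x. 2 * (cmod (f x))\<^sup>2 + 2 * (cmod (h x))\<^sup>2 \<partial>\<mu>)"
    using i bound by (intro integral_mono) auto
  also have "\<dots> = 2 * ?I f + 2 * ?I h"
    using i by simp
  also have "\<dots> \<le> (2 * (sqrt (?I f) + sqrt (?I h)))\<^sup>2"
    by (simp add: power2_sum power_mult_distrib)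
  finally show ?thesis
    unfolding L2_norm_def by (intro real_le_lsqrt) auto
qed

lemma L2_norm_scale: "L2_norm \<mu> (\<lambda>x. a * f x) = cmod a * L2_norm \<mu> f"
  by (simp add: L2_norm_def norm_mult power_mult_distrib real_sqrt_mult)

text \<open>Closing twice adds nothing. This is what allows approximation in stages: sets, then
  simple functions, then arbitrary square-integrable functions.\<close>

lemma L2_closure_limit:
  assumes f: "f \<in> L2_space \<mu>"
    and approx: "\<And>\<epsilon>. \<epsilon> > 0 \<Longrightarrow> \<exists>h \<in> L2_closure \<mu> S. L2_norm \<mu> (\<lambda>x. f x - h x) < \<epsilon>"
  shows "f \<in> L2_closure \<mu> S"
  unfolding L2_closure_def
proof (intro CollectI conjI allI impI f)
  fix \<epsilon> :: real assume "\<epsilon> > 0"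
  \<comment> \<open>Two errors below \<epsilon>/4 are added, and \<open>L2_norm_add_le\<close>
    doubles their sum.\<close>
  then obtain h where h: "h \<in> L2_closure \<mu> S" "L2_norm \<mu> (\<lambda>x. f x - h x) < \<epsilon> / 4"
    using approx[of "\<epsilon> / 4"] by auto
  with \<open>\<epsilon> > 0\<close> obtain k where k: "k \<in> S \<inter> L2_space \<mu>" "L2_norm \<mu> (\<lambda>x. h x - k x) < \<epsilon> / 4"
    unfolding L2_closure_def by (auto dest!: spec[of _ "\<epsilon> / 4"])
  have hL: "h \<in> L2_space \<mu>" using h by (simp add: L2_closure_def)
  have "L2_norm \<mu> (\<lambda>x. f x - k x) < \<epsilon>"
    using L2_norm_add_le[of "\<lambda>x. f x - h x" \<mu> "\<lambda>x. h x - k x"] f hL k h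
    by (simp add: L2_space_diff)
  with k show "\<exists>k\<in>S \<inter> L2_space \<mu>. L2_norm \<mu> (\<lambda>x. f x - k x) < \<epsilon>" by blast
qed

section \<open>Linear spans and their closures\<close>

lemma complex_span_add:
  assumes "f \<in> complex_span S" "h \<in> complex_span S"
  shows "(\<lambda>x. f x + h x) \<in> complex_span S"
proof -
  obtain F a where F: "finite F" "F \<subseteq> S" "f = (\<lambda>x. \<Sum>u\<in>F. a u * u x)"
    using assms(1) by (auto simp: complex_span_def)
  obtain G b where G: "finite G" "G \<subseteq> S" "h = (\<lambda>x. \<Sum>u\<in>G. b u * u x)"
    using assms(2) by (auto simp: complex_span_def)
  define c where "c u = (if u \<in> F then a u else 0) + (if u \<in> G then b u else 0)" for u
  have "(\<Sum>u\<in>F \<union> G. c u * u x) = f x + h x" for x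
  proof -
    have "(\<Sum>u\<in>F \<union> G. c u * u x) = (\<Sum>u\<in>F \<union> G. if u \<in> F then a u * u x else 0)
        + (\<Sum>u\<in>F \<union> G. if u \<in> G then b u * u x else 0)"
      unfolding sum.distrib[symmetric] by (rule sum.cong) (auto simp: c_def algebra_simps)
    also have "(\<Sum>u\<in>F \<union> G. if u \<in> F then a u * u x else 0) = (\<Sum>u\<in>F. a u * u x)"
      using F(1) G(1) by (intro sum.mono_neutral_cong_right) auto
    also have "(\<Sum>u\<in>F \<union> G. if u \<in> G then b u * u x else 0) = (\<Sum>u\<in>G. b u * u x)"
      using F(1) G(1) by (intro sum.mono_neutral_cong_right) auto
    finally show ?thesis using F G by simp
  qed
  then have "(\<lambda>x. f x + h x) = (\<lambda>x. \<Sum>u\<in>F \<union> G. c u * u x)" by auto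
  then show ?thesis
    unfolding complex_span_def using F(1,2) G(1,2) by blast
qed

lemma complex_span_scale:
  assumes "f \<in> complex_span S"
  shows "(\<lambda>x. c * f x) \<in> complex_span S"
proof -
  obtain F a where F: "finite F" "F \<subseteq> S" "f = (\<lambda>x. \<Sum>u\<in>F. a u * u x)"
    using assms by (auto simp: complex_span_def)
  then have "(\<lambda>x. c * f x) = (\<lambda>x. \<Sum>u\<in>F. (c * a u) * u x)"
    by (auto simp: sum_distrib_left mult.assoc)
  with F(1,2) show ?thesis
    unfolding complex_span_def by (intro CollectI exI[of _ F] exI[of _ "\<lambda>u. c * a u"]) auto
qed

lemma complex_span_zero: "(\<lambda>x. 0) \<in> complex_span S"
  unfolding complex_span_def by (intro CollectI exI[of _ "{}"]) auto

lemma complex_span_base: "f \<in> S \<Longrightarrow> f \<in> complex_span S"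
  unfolding complex_span_def by (intro CollectI exI[of _ "{f}"] exI[of _ "\<lambda>_. 1"]) auto

text \<open>The family \<open>f\<close> may repeat values, whereas \<open>complex_span\<close> sums
  over a set of functions. Adding one term at a time through \<open>complex_span_add\<close> merges
  the coefficients of terms that coincide.\<close>

lemma complex_span_sum:
  assumes "finite F" "\<And>i. i \<in> F \<Longrightarrow> f i \<in> S"
  shows "(\<lambda>x. \<Sum>i\<in>F. a i * f i x) \<in> complex_span S"
  using assms
proof (induction rule: finite_induct)
  case (insert j F)
  then show ?case
    using complex_span_add[OF complex_span_scale[OF complex_span_base[of "f j" S], of "a j"]] by simp
qed (simp add: complex_span_zero)

lemma L2_closure_span_scale:
  assumes f: "f \<in> L2_closure \<mu> (complex_span S)"
  shows "(\<lambda>x. c * f x) \<in> L2_closure \<mu> (complex_span S)"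
  unfolding L2_closure_def
proof (intro CollectI conjI allI impI)
  show "(\<lambda>x. c * f x) \<in> L2_space \<mu>"
    using f by (intro L2_space_scale) (simp add: L2_closure_def)
  fix \<epsilon> :: real assume e: "\<epsilon> > 0"
  \<comment> \<open>The summand 1 keeps the denominator positive when c = 0.\<close>
  have "\<epsilon> / (cmod c + 1) > 0"
    using e by (intro divide_pos_pos add_nonneg_pos) auto
  then obtain h where h: "h \<in> complex_span S \<inter> L2_space \<mu>"
    "L2_norm \<mu> (\<lambda>x. f x - h x) < \<epsilon> / (cmod c + 1)"
    using f unfolding L2_closure_def by blast
  have "cmod c * L2_norm \<mu> (\<lambda>x. f x - h x) \<le> (cmod c + 1) * L2_norm \<mu> (\<lambda>x. f x - h x)"
    by (intro mult_right_mono) (auto simp: L2_norm_def)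
  also have "\<dots> < \<epsilon>"
    using h(2) by (simp add: pos_less_divide_eq add_nonneg_pos mult.commute)
  finally have "L2_norm \<mu> (\<lambda>x. c * f x - c * h x) < \<epsilon>"
    using L2_norm_scale[of \<mu> c "\<lambda>x. f x - h x"] by (simp add: right_diff_distrib)
  then show "\<exists>h\<in>complex_span S \<inter> L2_space \<mu>. L2_norm \<mu> (\<lambda>x. c * f x - h x) < \<epsilon>"
    using h(1) by (intro bexI[of _ "\<lambda>x. c * h x"]) (auto intro: complex_span_scale L2_space_scale)
qed

lemma L2_closure_span_add:
  assumes f: "f \<in> L2_closure \<mu> (complex_span S)" and g: "g \<in> L2_closure \<mu> (complex_span S)"
  shows "(\<lambda>x. f x + g x) \<in> L2_closure \<mu> (complex_span S)"
  unfolding L2_closure_def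
proof (intro CollectI conjI allI impI)
  have L: "f \<in> L2_space \<mu>" "g \<in> L2_space \<mu>"
    using f g by (simp_all add: L2_closure_def)
  then show "(\<lambda>x. f x + g x) \<in> L2_space \<mu>"
    by (intro L2_space_add)
  fix \<epsilon> :: real assume e: "\<epsilon> > 0"
  then have "\<epsilon> / 4 > 0" by simp
  with f obtain h where h: "h \<in> complex_span S \<inter> L2_space \<mu>" "L2_norm \<mu> (\<lambda>x. f x - h x) < \<epsilon> / 4"
    unfolding L2_closure_def by blast
  from g \<open>\<epsilon> / 4 > 0\<close> obtain k where
    k: "k \<in> complex_span S \<inter> L2_space \<mu>" "L2_norm \<mu> (\<lambda>x. g x - k x) < \<epsilon> / 4"
    unfolding L2_closure_def by blast
  have "L2_norm \<mu> (\<lambda>x. (f x - h x) + (g x - k x)) < \<epsilon>"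
    using L2_norm_add_le[of "\<lambda>x. f x - h x" \<mu> "\<lambda>x. g x - k x"] L h k by (simp add: L2_space_diff)
  then have "L2_norm \<mu> (\<lambda>x. f x + g x - (h x + k x)) < \<epsilon>"
    by (simp add: algebra_simps)
  then show "\<exists>h\<in>complex_span S \<inter> L2_space \<mu>. L2_norm \<mu> (\<lambda>x. f x + g x - h x) < \<epsilon>"
    using h k by (intro bexI[of _ "\<lambda>x. h x + k x"]) (auto intro: complex_span_add L2_space_add)
qed

lemma L2_closure_span_zero: "(\<lambda>x. 0) \<in> L2_closure \<mu> (complex_span S)"
  unfolding L2_closure_def
  by (auto simp: zero_in_L2_space complex_span_zero L2_norm_def intro!: bexI[of _ "\<lambda>x. 0"])

lemma L2_closure_span_sum:
  assumes "finite F" "\<And>i. i \<in> F \<Longrightarrow> f i \<in> L2_closure \<mu> (complex_span S)"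
  shows "(\<lambda>x. \<Sum>i\<in>F. f i x) \<in> L2_closure \<mu> (complex_span S)"
  using assms
  by (induction rule: finite_induct) (auto simp: L2_closure_span_zero intro!: L2_closure_span_add)

text \<open>Dominated convergence for the squared errors turns pointwise convergence into
  convergence in norm. It serves twice below: for partial unions with the constant bound 1, and for
  simple functions with a multiple of |f|^2.\<close>

lemma L2_closure_dominated:
  assumes f: "f \<in> L2_space \<mu>"
    and F: "\<And>i::nat. F i \<in> L2_closure \<mu> S"
    and lim: "\<And>x. x \<in> space \<mu> \<Longrightarrow> (\<lambda>i. F i x) \<longlonglongrightarrow> f x"
    and w: "integrable \<mu> w" "\<And>i x. x \<in> space \<mu> \<Longrightarrow> (cmod (f x - F i x))\<^sup>2 \<le> w x"
  shows "f \<in> L2_closure \<mu> S"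
proof (rule L2_closure_limit[OF f])
  have [measurable]: "f \<in> borel_measurable \<mu>" "F i \<in> borel_measurable \<mu>" for i
    using f F[of i] by (auto simp: L2_space_def L2_closure_def)
  have "(\<lambda>i. \<integral>x. (cmod (f x - F i x))\<^sup>2 \<partial>\<mu>) \<longlonglongrightarrow> (\<integral>x. 0 \<partial>\<mu>)"
  proof (rule integral_dominated_convergence[OF _ _ w(1)])
    show "AE x in \<mu>. (\<lambda>i. (cmod (f x - F i x))\<^sup>2) \<longlonglongrightarrow> 0"
    proof (rule AE_I2)
      fix x assume "x \<in> space \<mu>"
      then have "(\<lambda>i. (cmod (f x - F i x))\<^sup>2) \<longlonglongrightarrow> (cmod (f x - f x))\<^sup>2"
        using lim by (intro tendsto_intros)
      then show "(\<lambda>i. (cmod (f x - F i x))\<^sup>2) \<longlonglongrightarrow> 0" by simp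
    qed
    show "AE x in \<mu>. norm ((cmod (f x - F i x))\<^sup>2) \<le> w x" for i
      using w(2) by (intro AE_I2) simp
  qed auto
  then have "(\<lambda>i. L2_norm \<mu> (\<lambda>x. f x - F i x)) \<longlonglongrightarrow> 0"
    unfolding L2_norm_def using tendsto_real_sqrt by fastforce
  then show "\<exists>h\<in>L2_closure \<mu> S. L2_norm \<mu> (\<lambda>x. f x - h x) < \<epsilon>" if "\<epsilon> > 0" for \<epsilon>
    using that F by (force dest: order_tendstoD(2) simp: eventually_sequentially)
qed

section \<open>From a generating pi-system to all of L^2\<close>

lemma (in finite_measure) indicator_in_L2_space:
  assumes [measurable]: "E \<in> sets M"
  shows "indicator E \<in> L2_space M"
  unfolding L2_space_def
proof (intro CollectI conjI)
  show "integrable M (\<lambda>x. (cmod (indicator E x))\<^sup>2)"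
    by (rule integrable_const_bound[of _ 1]) (auto simp: indicator_def)
qed measurable

text \<open>The measurable sets whose indicator lies in the closure form a Dynkin system:
  complements come from linearity, countable disjoint unions from dominated convergence. The
  pi-lambda theorem then reaches every measurable set, linearity every simple function, and
  dominated convergence every element of L^2.\<close>

lemma (in finite_measure) L2_closure_span_eq_L2_space:
  assumes gen: "sets M = sigma_sets (space M) \<C>" "\<C> \<subseteq> Pow (space M)" "Int_stable \<C>"
      "space M \<in> \<C>"
    and ind: "\<And>C. C \<in> \<C> \<Longrightarrow> indicator C \<in> L2_closure M (complex_span S)"
  shows "L2_closure M (complex_span S) = L2_space M"
proof
  let ?K = "L2_closure M (complex_span S)"
  show "?K \<subseteq> L2_space M" by (auto simp: L2_closure_def)
  have ind': "indicator Z \<in> ?K" if "Z \<in> sigma_sets (space M) \<C>" for Z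
    using gen(3,2) that
  proof (induction rule: sigma_sets_induct_disjoint)
    case (basic C)
    then show ?case by (rule ind)
  next
    case empty
    then show ?case using L2_closure_span_zero[of M S] by (simp add: indicator_def[abs_def])
  next
    case (compl Z)
    have "Z \<subseteq> space M" using compl.hyps gen(1) sets.sets_into_space by metis
    \<comment> \<open>A complement is a difference from the whole space, so the indicator of
      \<open>space M\<close> must itself be available; this is the use of
      \<open>space M \<in> \<C>\<close>.\<close>
    then have "indicator (space M - Z) = (\<lambda>x. indicator (space M) x + (-1) * (indicator Z x :: complex))"
      by (auto simp: fun_eq_iff indicator_def)
    with L2_closure_span_add[OF ind[OF gen(4)] L2_closure_span_scale[OF compl.IH, of "-1"]]
    show ?case by simp
  next
    case (union Z)
    have Zs: "Z i \<in> sets M" for i using union.hyps(2) gen(1) by auto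
    show ?case
    proof (rule L2_closure_dominated[where w = "\<lambda>_. 1" and F = "\<lambda>n. indicator (\<Union>i<n. Z i)"])
      show "indicator (\<Union>i. Z i) \<in> L2_space M"
        using Zs by (intro indicator_in_L2_space) auto
      show "indicator (\<Union>i<n. Z i) \<in> ?K" for n
      proof -
        have "disjoint_family_on Z {..<n}"
          using union.hyps(1) by (auto simp: disjoint_family_on_def)
        then have "indicator (\<Union>i<n. Z i) = (\<lambda>x. \<Sum>i<n. indicator (Z i) x :: complex)"
          by (intro ext indicator_UN_disjoint) auto
        then show ?thesis using union.IH by (simp add: L2_closure_span_sum)
      qed
      show "(\<lambda>n. indicator (\<Union>i<n. Z i) x) \<longlonglongrightarrow> (indicator (\<Union>i. Z i) x :: complex)" for x
        by (rule LIMSEQ_indicator_UN)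
    qed (auto simp: indicator_def)
  qed
  show "L2_space M \<subseteq> ?K"
  proof
    fix f assume f: "f \<in> L2_space M"
    then have [measurable]: "f \<in> borel_measurable M" and fi: "integrable M (\<lambda>x. (cmod (f x))\<^sup>2)"
      by (auto simp: L2_space_def)
    have "f \<in> borel_measurable M" by measurable
    from borel_measurable_implies_sequence_metric[OF this, of 0] obtain F where
      F: "\<And>i::nat. simple_function M (F i)"
        "\<And>x. x \<in> space M \<Longrightarrow> (\<lambda>i. F i x) \<longlonglongrightarrow> f x"
        "\<And>i x. x \<in> space M \<Longrightarrow> dist (F i x) 0 \<le> 2 * dist (f x) 0"
      by metis
    \<comment> \<open>Off \<open>space M\<close> the values of \<open>F i\<close> are arbitrary, so
      \<open>F i\<close> need not be a combination of indicators of measurable sets.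
      \<open>G i\<close> is one, and the two agree on the space.\<close>
    define G where "G i x = (\<Sum>y\<in>F i ` space M. y * indicator (F i -` {y} \<inter> space M) x)" for i x
    have GF: "G i x = F i x" if "x \<in> space M" for i x
    proof -
      have "G i x = (\<Sum>y\<in>F i ` space M. if y = F i x then y else 0)"
        unfolding G_def using that by (intro sum.cong) (auto simp: indicator_def)
      also have "\<dots> = F i x"
        using that simple_functionD(1)[OF F(1)[of i]] by simp
      finally show ?thesis .
    qed
    \<comment> \<open>The factor 9 is 3^2: the approximants satisfy |F i| \<le> 2|f|, hence |f - F
      i| \<le> 3|f|.\<close>
    show "f \<in> ?K"
    proof (rule L2_closure_dominated[where F = G and w = "\<lambda>x. 9 * (cmod (f x))\<^sup>2", OF f])
      show "G i \<in> ?K" for i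
        unfolding G_def[abs_def]
        using simple_functionD[OF F(1)[of i]] gen(1)
        by (intro L2_closure_span_sum L2_closure_span_scale ind') auto
      show "(\<lambda>i. G i x) \<longlonglongrightarrow> f x" if "x \<in> space M" for x
        using F(2)[OF that] GF[OF that] by simp
      show "integrable M (\<lambda>x. 9 * (cmod (f x))\<^sup>2)" using fi by simp
      show "(cmod (f x - G i x))\<^sup>2 \<le> 9 * (cmod (f x))\<^sup>2" if "x \<in> space M" for i x
      proof -
        have "cmod (f x - G i x) \<le> 3 * cmod (f x)"
          using norm_triangle_ineq4[of "f x" "F i x"] F(3)[OF that, of i] GF[OF that, of i] by simp
        then have "(cmod (f x - G i x))\<^sup>2 \<le> (3 * cmod (f x))\<^sup>2" by (intro power_mono) auto
        then show ?thesis by (simp add: power_mult_distrib)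
      qed
    qed
  qed
qed

text \<open>All norms vanish, so the zero function approximates everything. This settles the
  degenerate case in which \<open>measure_of\<close> returns the zero measure.\<close>

lemma L2_closure_span_null_measure:
  assumes "emeasure \<mu> (space \<mu>) = 0"
  shows "L2_closure \<mu> (complex_span S) = L2_space \<mu>"
proof -
  have "AE x in \<mu>. False" using assms by (intro AE_I[of _ _ "space \<mu>"]) auto
  then have "(\<integral>x. u x \<partial>\<mu>) = 0" for u :: "'a \<Rightarrow> real"
    by (intro integral_eq_zero_AE) auto
  then have "L2_norm \<mu> f = 0" for f
    by (simp add: L2_norm_def)
  then show ?thesis
    by (auto simp: L2_closure_def zero_in_L2_space intro!: bexI[of _ "\<lambda>x. 0"] complex_span_zero)
qed

section \<open>Borel sets of abstract topologies\<close>

lemma space_borel_on [simp]: "space (borel_on X) = topspace X"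
  unfolding borel_on_def by (intro space_measure_of) (auto dest: openin_subset)

lemma sets_borel_on: "sets (borel_on X) = sigma_sets (topspace X) {U. openin X U}"
  unfolding borel_on_def by (intro sets_measure_of) (auto dest: openin_subset)

lemma sets_borel_on_closed: "sets (borel_on T) \<subseteq> Pow (topspace T)"
  using sets.space_closed[of "borel_on T"] by simp

lemma sigma_sets_borel_on: "sigma_sets (topspace T) (sets (borel_on T)) = sets (borel_on T)"
  using sets.sigma_sets_eq[of "borel_on T"] by simp

lemma openin_sets_borel_on: "openin X U \<Longrightarrow> U \<in> sets (borel_on X)"
  by (auto simp: sets_borel_on)

lemma continuous_map_measurable_borel_on:
  assumes f: "continuous_map X Y f"
  shows "f \<in> measurable (borel_on X) (borel_on Y)"
  unfolding borel_on_def[of Y]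
proof (rule measurable_measure_of)
  show "f -` U \<inter> space (borel_on X) \<in> sets (borel_on X)" if "U \<in> {U. openin Y U}" for U
  proof -
    have "f -` U \<inter> space (borel_on X) = {x \<in> topspace X. f x \<in> U}" by auto
    with that f show ?thesis by (auto simp: continuous_map_def intro!: openin_sets_borel_on)
  qed
  show "f \<in> space (borel_on X) \<rightarrow> topspace Y"
    using f by (simp add: continuous_map_def)
qed (auto dest: openin_subset)

section \<open>Finiteness of the Riemannian volume\<close>

text \<open>By the Leibniz formula the determinant is a polynomial in the entries of the metric
  matrix, which are continuous in the coordinates.\<close>

lemma continuous_map_volume_density:
  assumes g: "riemannian_metric n M g" and c: "c \<in> atlas M"
  shows "continuous_map (subtopology (coord_space n) (chart_image c)) euclideanreal (volume_density n M g c)"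
proof -
  let ?T = "subtopology (coord_space n) (chart_image c)"
  have entry: "continuous_map ?T euclideanreal (\<lambda>z. metric_matrix n M g c z $$ (i, j))"
    if "i < n" "j < n" for i j
  proof -
    have "smooth_coord n (chart_image c) (\<lambda>z. metric_matrix n M g c z $$ (i, j))"
      using g c that by (simp add: riemannian_metric_def)
    then have "Ck_on n 0 (chart_image c) (\<lambda>z. metric_matrix n M g c z $$ (i, j))"
      unfolding smooth_coord_def by blast
    then show ?thesis by simp
  qed
  have dim: "metric_matrix n M g c z \<in> carrier_mat n n" for z
    by (simp add: metric_matrix_def)
  have "continuous_map ?T euclideanreal (\<lambda>z. Determinant.det (metric_matrix n M g c z))"
    unfolding det_def'[OF dim]
    by (intro continuous_map_sum continuous_map_real_mult continuous_map_prod entry)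
       (auto simp: finite_permutations permutes_in_image)
  \<comment> \<open>\<open>sqrt\<close> is continuous on the whole real line, negative arguments
    included.\<close>
  then have "continuous_map ?T euclideanreal (sqrt \<circ> (\<lambda>z. Determinant.det (metric_matrix n M g c z)))"
    by (rule continuous_map_compose) (simp add: continuous_on_real_sqrt)
  then show ?thesis
    by (simp add: o_def volume_density_def[abs_def])
qed

lemma coord_box:
  shows "openin (coord_space n) (Pi\<^sub>E {..<n} (\<lambda>i. {a i - 1<..<a i + 1}))"
    and "emeasure (coord_lebesgue n) (Pi\<^sub>E {..<n} (\<lambda>i. {a i - 1<..<a i + 1})) = 2 ^ n"
    and "Pi\<^sub>E {..<n} (\<lambda>i. {a i - 1<..<a i + 1}) \<in> sets (coord_lebesgue n)"
proof -
  interpret product_sigma_finite "\<lambda>_::nat. lborel :: real measure" ..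
  show "openin (coord_space n) (Pi\<^sub>E {..<n} (\<lambda>i. {a i - 1<..<a i + 1}))"
    by (simp add: openin_PiE)
  show "emeasure (coord_lebesgue n) (Pi\<^sub>E {..<n} (\<lambda>i. {a i - 1<..<a i + 1})) = 2 ^ n"
    by (subst emeasure_PiM) auto
  show "Pi\<^sub>E {..<n} (\<lambda>i. {a i - 1<..<a i + 1}) \<in> sets (coord_lebesgue n)"
    by (intro sets_PiM_I_finite) auto
qed

text \<open>Near the coordinates a of x the continuous density stays below its value at a plus 1.
  Intersecting with a cube of side 2 about a bounds the Lebesgue measure as well, so the volume is
  at most this bound times 2^n.\<close>

lemma riemannian_volume_locally_finite:
  assumes M: "smooth_manifold n M" and g: "riemannian_metric n M g"
    and vol: "riemannian_volume n M g \<mu>" and x: "x \<in> points M"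
  shows "\<exists>W. openin (mtop M) W \<and> x \<in> W \<and> emeasure \<mu> W < \<infinity>"
proof -
  have "x \<in> (\<Union>c\<in>atlas M. fst c)"
    using M x by (simp add: smooth_manifold_def)
  then obtain c where c: "c \<in> atlas M" "x \<in> fst c" by blast
  have "is_chart n (mtop M) c"
    using M c(1) unfolding smooth_manifold_def by blast
  then have dom: "openin (mtop M) (fst c)" and img: "openin (coord_space n) (chart_image c)"
    and homeo: "homeomorphic_map (subtopology (mtop M) (fst c))
      (subtopology (coord_space n) (chart_image c)) (snd c)"
    unfolding is_chart_def by blast+
  define \<rho> where "\<rho> = volume_density n M g c"
  let ?T = "subtopology (coord_space n) (chart_image c)"
  define a where "a = snd c x"
  define B where "B = Pi\<^sub>E {..<n} (\<lambda>i. {a i - 1<..<a i + 1})"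
  define V where "V = {z \<in> topspace ?T. \<rho> z \<in> {..<\<rho> a + 1}} \<inter> B"
  have "openin ?T {z \<in> topspace ?T. \<rho> z \<in> {..<\<rho> a + 1}}"
    using continuous_map_volume_density[OF g c(1)] unfolding \<rho>_def[symmetric]
    by (rule openin_continuous_map_preimage) simp
  then have "openin (coord_space n) {z \<in> topspace ?T. \<rho> z \<in> {..<\<rho> a + 1}}"
    using openin_trans_full[OF _ img] by blast
  then have V: "openin (coord_space n) V"
    unfolding V_def B_def by (intro openin_Int coord_box)
  have ci: "chart_image c \<subseteq> topspace (coord_space n)"
    using img by (rule openin_subset)
  have "a \<in> chart_image c" using c(2) by (simp add: a_def)
  moreover from this ci have "a \<in> Pi\<^sub>E {..<n} (\<lambda>_. UNIV)" by auto
  ultimately have aV: "a \<in> V"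
    by (simp add: V_def B_def PiE_iff)
  have cont: "continuous_map (subtopology (mtop M) (fst c)) (coord_space n) (snd c)"
    using homeomorphic_imp_continuous_map[OF homeo] by (simp add: continuous_map_in_subtopology)
  define W where "W = {y \<in> topspace (subtopology (mtop M) (fst c)). snd c y \<in> V}"
  have "openin (subtopology (mtop M) (fst c)) W"
    unfolding W_def using cont V by (rule openin_continuous_map_preimage)
  then have W: "openin (mtop M) W" "W \<subseteq> fst c"
    using openin_trans_full[OF _ dom] by (blast, auto simp: W_def)
  have "emeasure \<mu> W = (\<integral>\<^sup>+z\<in>snd c ` W. ennreal (\<rho> z) \<partial>coord_lebesgue n)"
    using vol c W unfolding riemannian_volume_def \<rho>_def by (simp add: openin_sets_borel_on)
  also have "\<dots> \<le> (\<integral>\<^sup>+z. ennreal (\<rho> a + 1) * indicator B z \<partial>coord_lebesgue n)"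
  proof (rule nn_integral_mono)
    fix z :: "nat \<Rightarrow> real"
    show "ennreal (\<rho> z) * indicator (snd c ` W) z \<le> ennreal (\<rho> a + 1) * indicator B z"
    proof (cases "z \<in> snd c ` W")
      case True
      then have "z \<in> V" unfolding W_def by blast
      then have "z \<in> B" "\<rho> z < \<rho> a + 1" unfolding V_def by blast+
      then show ?thesis using True by (simp add: ennreal_leI)
    qed simp
  qed
  also have "\<dots> = ennreal (\<rho> a + 1) * 2 ^ n"
    using coord_box[where n = n and a = a] by (simp add: nn_integral_cmult B_def)
  also have "\<dots> < \<infinity>"
    by (simp add: ennreal_mult_less_top power_less_top_ennreal)
  finally have "emeasure \<mu> W < \<infinity>" .
  moreover have "x \<in> W"
    unfolding W_def using aV[unfolded a_def] c(2) x by simp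
  ultimately show ?thesis using W by blast
qed

text \<open>Compactness leaves finitely many neighbourhoods of finite volume. The resulting bound on
  the base is later passed on to the solenoid.\<close>

lemma riemannian_volume_finite:
  assumes M: "smooth_manifold n M" and g: "riemannian_metric n M g"
    and vol: "riemannian_volume n M g \<mu>" and compact: "compact_space (mtop M)"
  shows "finite_measure \<mu>"
proof
  have sp: "space \<mu> = points M" and st: "sets \<mu> = sets (borel_on (mtop M))"
    using vol by (auto simp: riemannian_volume_def)
  let ?\<U> = "{W. openin (mtop M) W \<and> emeasure \<mu> W < \<infinity>}"
  have "points M \<subseteq> \<Union>?\<U>"
    using riemannian_volume_locally_finite[OF M g vol] by blast
  then obtain \<F> where \<F>: "finite \<F>" "\<F> \<subseteq> ?\<U>" "points M \<subseteq> \<Union>\<F>"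
    using compactinD[OF compact[unfolded compact_space_def], of ?\<U>] by force
  have "\<F> \<subseteq> sets \<mu>" using \<F>(2) st by (auto intro: openin_sets_borel_on)
  then have "emeasure \<mu> (space \<mu>) \<le> emeasure \<mu> (\<Union>W\<in>\<F>. W)"
    using \<F>(1,3) sp by (intro emeasure_mono) auto
  also have "\<dots> \<le> (\<Sum>W\<in>\<F>. emeasure \<mu> W)"
    using \<open>\<F> \<subseteq> sets \<mu>\<close> \<F>(1) by (intro emeasure_subadditive_finite) auto
  also have "\<dots> < \<infinity>"
    using \<F>(2) by (auto simp: ennreal_sum_less_top[OF \<F>(1)] less_top)
  finally show "emeasure \<mu> (space \<mu>) \<noteq> \<infinity>" by simp
qed

section \<open>Coverings and deck transformations\<close>

text \<open>The topological core of a covering from which uniqueness of lifts follows. Free of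
  smooth structure, it also applies directly to the identity maps of the tower.\<close>

definition sheeted :: "'a topology \<Rightarrow> 'b topology \<Rightarrow> ('a \<Rightarrow> 'b) \<Rightarrow> bool" where
  "sheeted X Y q \<longleftrightarrow> continuous_map X Y q \<and> q ` topspace X = topspace Y \<and>
     (\<forall>y\<in>topspace Y. \<exists>U. openin Y U \<and> y \<in> U \<and>
        (\<exists>\<V>. \<Union>\<V> = {x \<in> topspace X. q x \<in> U} \<and> pairwise disjnt \<V> \<and>
             (\<forall>V\<in>\<V>. openin X V \<and> inj_on q V)))"

lemma smooth_covering_sheeted:
  assumes "smooth_covering n M N q"
  shows "sheeted (mtop M) (mtop N) q"
  unfolding sheeted_def
proof (intro conjI ballI)
  show "continuous_map (mtop M) (mtop N) q" "q ` points M = points N"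
    using assms by (auto simp: smooth_covering_def smooth_map_on_def)
  fix y assume "y \<in> points N"
  then obtain U \<V> where "openin (mtop N) U" "y \<in> U" "\<Union>\<V> = {x \<in> points M. q x \<in> U}"
    "pairwise disjnt \<V>" "\<forall>V\<in>\<V>. openin (mtop M) V \<and> diffeomorphism_on n M V N U q"
    using assms unfolding smooth_covering_def by blast
  then show "\<exists>U. openin (mtop N) U \<and> y \<in> U \<and> (\<exists>\<V>. \<Union>\<V> = {x \<in> points M. q x \<in> U} \<and>
      pairwise disjnt \<V> \<and> (\<forall>V\<in>\<V>. openin (mtop M) V \<and> inj_on q V))"
    by (intro exI[of _ U] conjI exI[of _ \<V>]) (auto simp: diffeomorphism_on_def bij_betw_def)
qed

lemma sheeted_id: "sheeted X X id"
  unfolding sheeted_def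
proof (intro conjI ballI)
  fix y assume "y \<in> topspace X"
  then show "\<exists>U. openin X U \<and> y \<in> U \<and> (\<exists>\<V>. \<Union>\<V> = {x \<in> topspace X. id x \<in> U} \<and>
      pairwise disjnt \<V> \<and> (\<forall>V\<in>\<V>. openin X V \<and> inj_on id V))"
    by (intro exI[of _ "topspace X"] conjI exI[of _ "{topspace X}"]) (auto simp: pairwise_def)
qed auto

text \<open>At each point w the values of the two lifts lie in sheets over a common neighbourhood.
  If the sheets are the same, injectivity makes the lifts agree near w; if they differ, disjointness
  makes the lifts differ near w. Hence the set of agreement and its complement are both open, and
  connectedness decides.\<close>

lemma sheeted_unique_lift:
  assumes q: "sheeted X Y q" and Z: "connected_space Z"
    and f: "continuous_map Z X f" and g: "continuous_map Z X g"
    and qfg: "\<And>z. z \<in> topspace Z \<Longrightarrow> q (f z) = q (g z)"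
    and z0: "z0 \<in> topspace Z" "f z0 = g z0"
    and z: "z \<in> topspace Z"
  shows "f z = g z"
proof (rule ccontr)
  assume neq: "f z \<noteq> g z"
  let ?E = "{z \<in> topspace Z. f z = g z}" and ?D = "{z \<in> topspace Z. f z \<noteq> g z}"
  have local: "\<exists>T. openin Z T \<and> w \<in> T \<and> (T \<subseteq> ?E \<or> T \<subseteq> ?D)" if w: "w \<in> topspace Z" for w
  proof -
    have fw: "f w \<in> topspace X" "g w \<in> topspace X"
      using f g w by (auto simp: continuous_map_def)
    then have "q (f w) \<in> topspace Y"
      using q by (auto simp: sheeted_def)
    then obtain U \<V> where U: "openin Y U" "q (f w) \<in> U"
      and \<V>: "\<Union>\<V> = {x \<in> topspace X. q x \<in> U}" "pairwise disjnt \<V>"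
        "\<And>V. V \<in> \<V> \<Longrightarrow> openin X V" "\<And>V. V \<in> \<V> \<Longrightarrow> inj_on q V"
      using q unfolding sheeted_def by meson
    have "f w \<in> \<Union>\<V>" "g w \<in> \<Union>\<V>"
      unfolding \<V>(1) using fw U(2) qfg[OF w] by auto
    then obtain V V' where V: "V \<in> \<V>" "f w \<in> V" "V' \<in> \<V>" "g w \<in> V'" by blast
    define T where "T = {z \<in> topspace Z. f z \<in> V} \<inter> {z \<in> topspace Z. g z \<in> V'}"
    have "openin Z T"
      unfolding T_def using f g V \<V>(3) by (intro openin_Int openin_continuous_map_preimage) auto
    moreover have "w \<in> T" using V w by (simp add: T_def)
    moreover have "T \<subseteq> ?E \<or> T \<subseteq> ?D"
    proof (cases "V = V'")
      case True
      then have "T \<subseteq> ?E"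
        using \<V>(4)[OF V(1)] qfg by (auto simp: T_def inj_on_def)
      then show ?thesis ..
    next
      case False
      then have "V \<inter> V' = {}"
        using \<V>(2) V by (auto simp: pairwise_def disjnt_def)
      then have "T \<subseteq> ?D" by (auto simp: T_def)
      then show ?thesis ..
    qed
    ultimately show ?thesis by blast
  qed
  have "openin Z ?E"
    unfolding openin_subopen[of Z ?E] using local by blast
  moreover have "openin Z ?D"
    unfolding openin_subopen[of Z ?D] using local by blast
  moreover have "topspace Z \<subseteq> ?E \<union> ?D" "?E \<inter> ?D = {}" "?E \<noteq> {}" "?D \<noteq> {}"
    using z0 z neq by auto
  ultimately show False
    using Z unfolding connected_space_def by meson
qed

lemma deck_group_carrier:
  "h \<in> carrier (deck_group X q) \<longleftrightarrow> h \<in> Bij (topspace X) \<and> homeomorphic_map X X h \<and>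
     (\<forall>x\<in>topspace X. q (h x) = q x)"
  by (simp add: deck_group_def)

lemma deck_group_continuous: "h \<in> carrier (deck_group X q) \<Longrightarrow> continuous_map X X h"
  by (simp add: deck_group_carrier homeomorphic_imp_continuous_map)

lemma deck_group_in_topspace: "h \<in> carrier (deck_group X q) \<Longrightarrow> x \<in> topspace X \<Longrightarrow> h x \<in> topspace X"
  using deck_group_continuous[of h X q] by (auto simp: continuous_map_def)

lemma deck_group_proj: "h \<in> carrier (deck_group X q) \<Longrightarrow> x \<in> topspace X \<Longrightarrow> q (h x) = q x"
  by (simp add: deck_group_carrier)

lemma deck_group_mult:
  assumes "h \<in> carrier (deck_group X q)" "k \<in> carrier (deck_group X q)"
  shows "h \<otimes>\<^bsub>deck_group X q\<^esub> k = compose (topspace X) h k"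
  using assms by (simp add: deck_group_carrier deck_group_def BijGroup_def)

lemma deck_group_compose:
  assumes h: "h \<in> carrier (deck_group X q)" and k: "k \<in> carrier (deck_group X q)"
  shows "compose (topspace X) h k \<in> carrier (deck_group X q)"
  unfolding deck_group_carrier
proof (intro conjI ballI)
  show "compose (topspace X) h k \<in> Bij (topspace X)"
    using h k by (simp add: deck_group_carrier compose_Bij)
  have "homeomorphic_map X X (h \<circ> k)"
    using h k by (auto simp: deck_group_carrier intro: homeomorphic_map_compose)
  then show "homeomorphic_map X X (compose (topspace X) h k)"
    by (rule homeomorphic_map_eq) (simp add: compose_def)
  show "q (compose (topspace X) h k x) = q x" if "x \<in> topspace X" for x
    using that deck_group_proj[OF h, of "k x"] deck_group_proj[OF k that] deck_group_in_topspace[OF k that]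
    by (simp add: compose_def)
qed

text \<open>A deck transformation is a lift of \<open>q\<close> through \<open>q\<close> itself, so
  one value determines it on X: the action is free. Members of \<open>Bij\<close> are extensional,
  which upgrades agreement on X to equality.\<close>

lemma deck_group_eqI:
  assumes q: "sheeted X Y q" and X: "connected_space X"
    and h: "h \<in> carrier (deck_group X q)" and k: "k \<in> carrier (deck_group X q)"
    and x: "x \<in> topspace X" "h x = k x"
  shows "h = k"
proof (rule extensionalityI)
  show "h \<in> extensional (topspace X)" "k \<in> extensional (topspace X)"
    using h k by (auto simp: deck_group_carrier Bij_def)
  show "h y = k y" if "y \<in> topspace X" for y
    using sheeted_unique_lift[OF q X deck_group_continuous[OF h] deck_group_continuous[OF k] _ x that]
      deck_group_proj[OF h] deck_group_proj[OF k] by simp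
qed

section \<open>Towers of regular coverings\<close>

lemma tower_map_self [simp]: "tower_map p i i = id"
  by (cases i) simp_all

lemma tower_map_comp:
  assumes "i \<le> j" "j \<le> k"
  shows "tower_map p j i (tower_map p k j x) = tower_map p k i x"
  using assms
proof (induction k arbitrary: x)
  case (Suc k)
  then show ?case by (cases "j = Suc k") auto
qed simp

text \<open>The topological content of the tower. The case i = j, where the map is the identity, is
  included in \<open>sheets\<close>. Transitivity is stated over level 0 because the solenoid group
  is assembled from the deck groups over that level.\<close>

locale covering_tower =
  fixes X :: "nat \<Rightarrow> 'a topology" and p :: "nat \<Rightarrow> 'a \<Rightarrow> 'a"
  assumes conn: "connected_space (X k)"
    and sheets: "i \<le> j \<Longrightarrow> sheeted (X j) (X i) (tower_map p j i)"
    and finite_fibre: "y \<in> topspace (X 0) \<Longrightarrow> finite (fibre (X j) (tower_map p j 0) y)"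
    and deck_transitive: "x \<in> topspace (X j) \<Longrightarrow> x' \<in> topspace (X j) \<Longrightarrow>
        tower_map p j 0 x = tower_map p j 0 x' \<Longrightarrow> \<exists>h\<in>carrier (level_deck_group X p j). h x = x'"
begin

abbreviation "S \<equiv> topspace (solenoid X p)"
abbreviation "D \<equiv> level_deck_group X p"
abbreviation "G \<equiv> solenoid_group X p"

lemma tower_map_in: "i \<le> j \<Longrightarrow> x \<in> topspace (X j) \<Longrightarrow> tower_map p j i x \<in> topspace (X i)"
  using sheets[of i j] by (auto simp: sheeted_def)

lemma tower_map_continuous: "i \<le> j \<Longrightarrow> continuous_map (X j) (X i) (tower_map p j i)"
  using sheets[of i j] by (auto simp: sheeted_def)

lemma S_iff: "x \<in> S \<longleftrightarrow> (\<forall>i. x i \<in> topspace (X i)) \<and> (\<forall>i j. i < j \<longrightarrow> tower_map p j i (x j) = x i)"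
  by (auto simp: solenoid_def)

lemma S_proj: "x \<in> S \<Longrightarrow> i \<le> j \<Longrightarrow> tower_map p j i (x j) = x i"
  by (cases "i = j") (auto simp: S_iff)

lemma S_in: "x \<in> S \<Longrightarrow> x i \<in> topspace (X i)"
  by (simp add: S_iff)

lemma continuous_map_level: "continuous_map (solenoid X p) (X k) (\<lambda>x. x k)"
  unfolding solenoid_def
  by (intro continuous_map_from_subtopology continuous_map_product_projection) simp

text \<open>The projection to level k is onto: preimages are chosen upwards from level k by
  dependent choice, and the lower coordinates are forced by projecting down.\<close>

lemma thread_through:
  assumes z: "z \<in> topspace (X k)"
  shows "\<exists>x\<in>S. x k = z"
proof -
  have "\<exists>w. \<forall>m. (w m \<in> topspace (X (k + m)) \<and> (m = 0 \<longrightarrow> w m = z)) \<and> p (k + m) (w (Suc m)) = w m"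
  proof (rule dependent_nat_choice)
    show "\<exists>x. x \<in> topspace (X (k + 0)) \<and> (0 = (0::nat) \<longrightarrow> x = z)"
      using z by auto
    fix x m assume "x \<in> topspace (X (k + m)) \<and> (m = 0 \<longrightarrow> x = z)"
    moreover have "p (k + m) ` topspace (X (Suc (k + m))) = topspace (X (k + m))"
      using sheets[of "k + m" "Suc (k + m)"] by (simp add: sheeted_def)
    ultimately have "x \<in> p (k + m) ` topspace (X (Suc (k + m)))" by simp
    then show "\<exists>y. (y \<in> topspace (X (k + Suc m)) \<and> (Suc m = 0 \<longrightarrow> y = z)) \<and> p (k + m) y = x"
      by auto
  qed
  then obtain w where w: "\<And>m. w m \<in> topspace (X (k + m))" "w 0 = z" "\<And>m. p (k + m) (w (Suc m)) = w m"
    by blast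
  have step: "tower_map p (k + j) (k + i) (w j) = w i" if "i \<le> j" for i j
    using that
  proof (induction rule: dec_induct)
    case (step j)
    have "tower_map p (k + Suc j) (k + i) (w (Suc j)) = tower_map p (k + j) (k + i) (p (k + j) (w (Suc j)))"
      using step.hyps by simp
    also have "\<dots> = w i" using w(3) step.IH by simp
    finally show ?case .
  qed simp
  \<comment> \<open>Here \<open>w i\<close> lives on level k + i, which is at least i whether or not
    i \<le> k, so one formula gives all coordinates.\<close>
  define x where "x i = tower_map p (k + i) i (w i)" for i
  have "x \<in> S"
    unfolding S_iff
  proof (intro conjI allI impI)
    show "x i \<in> topspace (X i)" for i
      unfolding x_def by (intro tower_map_in w) simp
    fix i j :: nat assume "i < j"
    have "tower_map p j i (x j) = tower_map p (k + j) i (w j)"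
      unfolding x_def using \<open>i < j\<close> by (intro tower_map_comp) auto
    also have "\<dots> = tower_map p (k + i) i (tower_map p (k + j) (k + i) (w j))"
      using \<open>i < j\<close> by (intro tower_map_comp[symmetric]) auto
    finally show "tower_map p j i (x j) = x i"
      using \<open>i < j\<close> by (simp add: step x_def)
  qed
  moreover have "x k = z"
    using step[of 0 k] w(2) by (simp add: x_def)
  ultimately show ?thesis by blast
qed

section \<open>The group of the solenoid and its action on threads\<close>

lemma G_carrier:
  "h \<in> carrier G \<longleftrightarrow> (\<forall>i. h i \<in> carrier (D i)) \<and>
     (\<forall>i j. i < j \<longrightarrow> (\<forall>x\<in>topspace (X j). tower_map p j i (h j x) = h i (tower_map p j i x)))"
  by (auto simp: solenoid_group_def PiE_iff)

lemma G_component: "h \<in> carrier G \<Longrightarrow> h i \<in> carrier (D i)"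
  by (simp add: G_carrier)

lemma G_compatible:
  "h \<in> carrier G \<Longrightarrow> i < j \<Longrightarrow> x \<in> topspace (X j) \<Longrightarrow>
     tower_map p j i (h j x) = h i (tower_map p j i x)"
  by (simp add: G_carrier)

lemma G_mult:
  assumes "a \<in> carrier G" "h \<in> carrier G"
  shows "(a \<otimes>\<^bsub>G\<^esub> h) i = compose (topspace (X i)) (a i) (h i)"
  using assms by (simp add: solenoid_group_def deck_group_mult PiE_iff product_group_def)

lemma G_closed:
  assumes a: "a \<in> carrier G" and h: "h \<in> carrier G"
  shows "a \<otimes>\<^bsub>G\<^esub> h \<in> carrier G"
  unfolding G_carrier
proof (intro conjI allI impI ballI)
  show "(a \<otimes>\<^bsub>G\<^esub> h) i \<in> carrier (D i)" for i
    unfolding G_mult[OF a h] by (intro deck_group_compose G_component a h)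
  fix i j :: nat and x assume ij: "i < j" and x: "x \<in> topspace (X j)"
  have "h j x \<in> topspace (X j)"
    by (rule deck_group_in_topspace[OF G_component[OF h] x])
  then show "tower_map p j i ((a \<otimes>\<^bsub>G\<^esub> h) j x) = (a \<otimes>\<^bsub>G\<^esub> h) i (tower_map p j i x)"
    unfolding G_mult[OF a h]
    using G_compatible[OF a ij] G_compatible[OF h ij x] ij x tower_map_in[of i j x]
    by (simp add: compose_def)
qed

lemma G_action:
  assumes h: "h \<in> carrier G" and b: "b \<in> S"
  shows "(\<lambda>i. h i (b i)) \<in> S" and "h 0 (b 0) = b 0"
proof -
  show "(\<lambda>i. h i (b i)) \<in> S"
    unfolding S_iff
  proof (intro conjI allI impI)
    show "h i (b i) \<in> topspace (X i)" for i
      by (rule deck_group_in_topspace[OF G_component[OF h] S_in[OF b]])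
    show "tower_map p j i (h j (b j)) = h i (b i)" if "i < j" for i j
      using that G_compatible[OF h that S_in[OF b]] S_proj[OF b, of i j] by simp
  qed
  from deck_group_proj[OF G_component[OF h, of 0] S_in[OF b]] show "h 0 (b 0) = b 0" by simp
qed

text \<open>The deck transformations may be picked independently at each level, subject to
  \<open>h i (b i) = y i\<close>. Compatibility is then automatic: projecting after
  \<open>h j\<close> and applying \<open>h i\<close> after projecting are two lifts, through the
  covering of level 0 by level i, of the same map on the connected space X_j, and they agree at
  \<open>b j\<close>.\<close>

lemma G_transitive:
  assumes b: "b \<in> S" and y: "y \<in> S" and by0: "b 0 = y 0"
  shows "\<exists>h\<in>carrier G. \<forall>i. h i (b i) = y i"
proof -
  have "\<exists>h\<in>carrier (D i). h (b i) = y i" for i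
    using S_in[OF b, of i] S_in[OF y, of i] by0 S_proj[OF b, of 0 i] S_proj[OF y, of 0 i]
    by (intro deck_transitive) auto
  then obtain h where h: "\<And>i. h i \<in> carrier (D i)" "\<And>i. h i (b i) = y i"
    by metis
  have "tower_map p j i (h j x) = h i (tower_map p j i x)" if ij: "i < j" and x: "x \<in> topspace (X j)"
    for i j x
  proof (rule sheeted_unique_lift[OF sheets[of 0 i] conn[of j] _ _ _ S_in[OF b] _ x])
    show "continuous_map (X j) (X i) (\<lambda>x. tower_map p j i (h j x))"
      using continuous_map_compose[OF deck_group_continuous[OF h(1)[of j]] tower_map_continuous[of i j]] ij
      by (simp add: o_def)
    show "continuous_map (X j) (X i) (\<lambda>x. h i (tower_map p j i x))"
      using continuous_map_compose[OF tower_map_continuous[of i j] deck_group_continuous[OF h(1)[of i]]] ij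
      by (simp add: o_def)
    show "tower_map p i 0 (tower_map p j i (h j z)) = tower_map p i 0 (h i (tower_map p j i z))"
      if z: "z \<in> topspace (X j)" for z
      using ij deck_group_proj[OF h(1)[of j] z] deck_group_proj[OF h(1)[of i], of "tower_map p j i z"]
        tower_map_in[of i j z] z by (simp add: tower_map_comp)
    show "tower_map p j i (h j (b j)) = h i (tower_map p j i (b j))"
      using ij S_proj[OF b, of i j] S_proj[OF y, of i j] by (simp add: h(2))
  qed simp
  then have "h \<in> carrier G" using h(1) by (simp add: G_carrier)
  with h(2) show ?thesis by blast
qed

text \<open>The action on a fibre is simply transitive: free by uniqueness of lifts, transitive by
  regularity. Points of a fibre can thus be counted in the deck group.\<close>

lemma deck_bij_fibre:
  assumes b: "b \<in> topspace (X k)"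
  shows "bij_betw (\<lambda>d. d b) (carrier (D k)) (fibre (X k) (tower_map p k 0) (tower_map p k 0 b))"
  unfolding bij_betw_def
proof
  show "inj_on (\<lambda>d. d b) (carrier (D k))"
    using deck_group_eqI[OF sheets[of 0 k] conn _ _ b] by (auto simp: inj_on_def)
  show "(\<lambda>d. d b) ` carrier (D k) = fibre (X k) (tower_map p k 0) (tower_map p k 0 b)"
  proof (intro equalityI subsetI)
    fix x assume "x \<in> fibre (X k) (tower_map p k 0) (tower_map p k 0 b)"
    then show "x \<in> (\<lambda>d. d b) ` carrier (D k)"
      using deck_transitive[OF b, of x] by (auto simp: fibre_def)
  qed (use b in \<open>auto simp: fibre_def deck_group_proj deck_group_in_topspace\<close>)
qed

text \<open>The union must be countable for use with sigma-algebras, which is why it is indexed by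
  the levels and not by the boxes contained in W.\<close>

lemma openin_solenoid_level_union:
  assumes W: "openin (solenoid X p) W"
  shows "\<exists>U. (\<forall>k. openin (X k) (U k)) \<and> W = (\<Union>k. {x \<in> S. x k \<in> U k})"
proof -
  \<comment> \<open>The largest open set on level k whose cylinder is contained in W. All boxes that
    can be read off on level k are absorbed at once.\<close>
  define U where "U k = \<Union>{V. openin (X k) V \<and> {x \<in> S. x k \<in> V} \<subseteq> W}" for k
  have U: "openin (X k) (U k)" for k unfolding U_def by auto
  have "\<exists>k. x k \<in> U k" if x: "x \<in> W" for x
  proof -
    obtain T where T: "openin (product_topology X UNIV) T"
      "W = T \<inter> {x. \<forall>i j. i < j \<longrightarrow> tower_map p j i (x j) = x i}"
      using W by (auto simp: solenoid_def openin_subtopology)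
    have xS: "x \<in> S" using openin_subset[OF W] x by auto
    obtain V where V: "finite {i. V i \<noteq> topspace (X i)}" "\<And>i. openin (X i) (V i)"
      "x \<in> Pi\<^sub>E UNIV V" "Pi\<^sub>E UNIV V \<subseteq> T"
      using T x by (auto simp: openin_product_topology_alt)
    \<comment> \<open>Beyond k the box imposes no condition; up to k its conditions are pulled back
      to level k and intersected in \<open>Q\<close>.\<close>
    obtain k where k: "\<And>i. V i \<noteq> topspace (X i) \<Longrightarrow> i \<le> k"
      using V(1) by (auto simp: finite_nat_set_iff_bounded_le)
    define Q where "Q = (\<Inter>i\<in>{..k}. {z \<in> topspace (X k). tower_map p k i z \<in> V i})"
    have "openin (X k) Q"
      unfolding Q_def using V(2)
      by (intro openin_INT2 openin_continuous_map_preimage[OF tower_map_continuous]) auto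
    moreover have "{x \<in> S. x k \<in> Q} \<subseteq> W"
    proof
      fix y assume y: "y \<in> {x \<in> S. x k \<in> Q}"
      have "y i \<in> V i" for i
      proof (cases "i \<le> k")
        case True
        then have "tower_map p k i (y k) \<in> V i" using y unfolding Q_def by blast
        then show ?thesis using y True S_proj[of y i k] by simp
      next
        case False
        then show ?thesis using k[of i] y S_in[of y i] by auto
      qed
      then show "y \<in> W" using V(4) y by (auto simp: T(2) S_iff)
    qed
    moreover have "x k \<in> Q"
      using V(3) S_proj[OF xS] S_in[OF xS] by (auto simp: Q_def PiE_iff)
    ultimately show ?thesis unfolding U_def by blast
  qed
  then have "W \<subseteq> (\<Union>k. {x \<in> S. x k \<in> U k})"
    using openin_subset[OF W] by blast
  moreover have "{x \<in> S. x k \<in> U k} \<subseteq> W" for k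
    unfolding U_def by blast
  then have "(\<Union>k. {x \<in> S. x k \<in> U k}) \<subseteq> W"
    by (rule UN_least)
  ultimately have "W = (\<Union>k. {x \<in> S. x k \<in> U k})"
    by (rule equalityI)
  with U show ?thesis by blast
qed

section \<open>Cylinder sets as a generating pi-system\<close>

definition cylinders :: "(nat \<Rightarrow> 'a) set set" where
  "cylinders = {{x \<in> S. x k \<in> E} | k E. E \<in> sets (borel_on (X k))}"

lemma level_measurable: "(\<lambda>x. x k) \<in> measurable (borel_on (solenoid X p)) (borel_on (X k))"
  by (intro continuous_map_measurable_borel_on continuous_map_level)

lemma cylinder_measurable:
  assumes "E \<in> sets (borel_on (X k))"
  shows "{x \<in> S. x k \<in> E} \<in> sets (borel_on (solenoid X p))"
proof -
  have "{x \<in> S. x k \<in> E} = (\<lambda>x. x k) -` E \<inter> space (borel_on (solenoid X p))" by auto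
  with measurable_sets[OF level_measurable assms] show ?thesis by simp
qed

lemma sets_borel_on_solenoid: "sets (borel_on (solenoid X p)) = sigma_sets S cylinders"
proof
  have "W \<in> sigma_sets S cylinders" if "openin (solenoid X p) W" for W
  proof -
    from openin_solenoid_level_union[OF that] obtain U where
      U: "\<forall>k. openin (X k) (U k)" "W = (\<Union>k. {x \<in> S. x k \<in> U k})" by blast
    then have "{x \<in> S. x k \<in> U k} \<in> cylinders" for k
      by (auto simp: cylinders_def intro: openin_sets_borel_on)
    then show ?thesis
      unfolding U(2) by (intro sigma_sets.Union sigma_sets.Basic)
  qed
  then show "sets (borel_on (solenoid X p)) \<subseteq> sigma_sets S cylinders"
    unfolding sets_borel_on by (intro sigma_sets_mono) auto
  have "cylinders \<subseteq> sets (borel_on (solenoid X p))"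
    by (auto simp: cylinders_def cylinder_measurable)
  then show "sigma_sets S cylinders \<subseteq> sets (borel_on (solenoid X p))"
    using sets.sigma_sets_subset[of cylinders "borel_on (solenoid X p)"] by simp
qed

text \<open>Of two cylinders, the one on the lower level is also a cylinder on the higher level,
  over the preimage of its base.\<close>

lemma Int_stable_cylinders: "Int_stable cylinders"
proof (rule Int_stableI)
  have *: "{x \<in> S. x j \<in> E} \<inter> {x \<in> S. x k \<in> F} \<in> cylinders"
    if "j \<le> k" "E \<in> sets (borel_on (X j))" "F \<in> sets (borel_on (X k))" for j k E F
  proof -
    have "tower_map p k j -` E \<inter> space (borel_on (X k)) \<inter> F \<in> sets (borel_on (X k))"
      using measurable_sets[OF continuous_map_measurable_borel_on[OF tower_map_continuous[OF that(1)]] that(2)]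
        that(3) by blast
    moreover have "{x \<in> S. x j \<in> E} \<inter> {x \<in> S. x k \<in> F}
        = {x \<in> S. x k \<in> tower_map p k j -` E \<inter> space (borel_on (X k)) \<inter> F}"
      using that(1) S_proj S_in by auto
    ultimately show ?thesis unfolding cylinders_def by blast
  qed
  fix C C' assume "C \<in> cylinders" "C' \<in> cylinders"
  then obtain j k E F where "C = {x \<in> S. x j \<in> E}" "C' = {x \<in> S. x k \<in> F}"
    "E \<in> sets (borel_on (X j))" "F \<in> sets (borel_on (X k))"
    unfolding cylinders_def by blast
  then show "C \<inter> C' \<in> cylinders"
    using *[of j k E F] *[of k j F E] by (cases "j \<le> k") (auto simp: Int_commute)
qed

lemma S_in_cylinders: "S \<in> cylinders"
proof -
  have "S = {x \<in> S. x 0 \<in> topspace (X 0)}" using S_in by auto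
  then show ?thesis
    unfolding cylinders_def using openin_sets_borel_on[OF openin_topspace, of "X 0"] by blast
qed

end

section \<open>Haar measure and the level measures\<close>

locale haar_tower = covering_tower X p
  for X :: "nat \<Rightarrow> 'a topology" and p :: "nat \<Rightarrow> 'a \<Rightarrow> 'a" +
  fixes H :: "(nat \<Rightarrow> 'a \<Rightarrow> 'a) measure"
  assumes haar: "haar_probability G (solenoid_group_topology X p) H"
begin

lemma space_H: "space H = carrier G"
  and sets_H: "sets H = sets (borel_on (solenoid_group_topology X p))"
  and H_total: "emeasure H (carrier G) = 1"
  and H_invariant: "a \<in> carrier G \<Longrightarrow> E \<in> sets H \<Longrightarrow> emeasure H (a <#\<^bsub>G\<^esub> E) = emeasure H E"
  using haar by (auto simp: haar_probability_def)

sublocale prob_space H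
  by (rule prob_spaceI) (simp add: space_H H_total)

lemma topspace_G: "topspace (solenoid_group_topology X p) = carrier G"
  by (auto simp: solenoid_group_topology_def G_component)

lemma continuous_map_component:
  "continuous_map (solenoid_group_topology X p) (discrete_topology (carrier (D k))) (\<lambda>h. h k)"
  unfolding solenoid_group_topology_def
  by (intro continuous_map_from_subtopology
      continuous_map_product_projection[where X = "\<lambda>i. discrete_topology (carrier (D i))"]) simp

text \<open>The k-th component is a continuous map to a discrete space, so the condition is open for
  every set \<open>Q\<close>.\<close>

lemma component_event:
  "{h \<in> carrier G. h k \<in> Q} \<in> sets H"
proof -
  have "{h \<in> carrier G. h k \<in> Q} = {h \<in> topspace (solenoid_group_topology X p). h k \<in> Q \<inter> carrier (D k)}"
    by (auto simp: topspace_G G_component)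
  moreover have "openin (solenoid_group_topology X p) \<dots>"
    by (rule openin_continuous_map_preimage[OF continuous_map_component]) simp
  ultimately show ?thesis by (simp add: sets_H openin_sets_borel_on)
qed

text \<open>Each coordinate of the orbit map factors through a discrete deck group, on which every
  map into X_i is continuous. The resulting measurability is what makes the push-forward in
  \<open>fibre_measure\<close> meaningful.\<close>

lemma orbit_continuous:
  assumes b: "b \<in> solenoid_fibre X p x"
  shows "continuous_map (solenoid_group_topology X p)
           (subtopology (solenoid X p) (solenoid_fibre X p x)) (\<lambda>h i. h i (b i))"
proof -
  let ?T = "solenoid_group_topology X p"
  have bS: "b \<in> S" "b 0 = x"
    using b by (auto simp: solenoid_fibre_def fibre_def)
  have "continuous_map ?T (X i) (\<lambda>h. h i (b i))" for i
  proof -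
    have "continuous_map (discrete_topology (carrier (D i))) (X i) (\<lambda>d. d (b i))"
      using deck_group_in_topspace[where q = "tower_map p i 0", OF _ S_in[OF bS(1)]] by (simp add: Pi_iff)
    from continuous_map_compose[OF continuous_map_component this] show ?thesis
      by (simp add: o_def)
  qed
  then have "continuous_map ?T (product_topology X UNIV) (\<lambda>h i. h i (b i))"
    by (simp add: continuous_map_componentwise_UNIV)
  then have "continuous_map ?T (solenoid X p) (\<lambda>h i. h i (b i))"
    using G_action(1)[OF _ bS(1)]
    by (auto simp: solenoid_def continuous_map_in_subtopology topspace_G)
  then show ?thesis
    using G_action[OF _ bS(1)] bS(2)
    by (auto simp: continuous_map_in_subtopology topspace_G solenoid_fibre_def fibre_def)
qed

lemma component_measure:
  assumes y: "y \<in> topspace (X 0)" and d: "d \<in> carrier (D k)"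
  shows "measure H {h \<in> carrier G. h k = d} = 1 / real (order (D k))"
    and "finite (carrier (D k))"
proof -
  obtain b where b: "b \<in> S" "b 0 = y" using thread_through[OF y] by blast
  let ?bk = "b k"
  have bk: "?bk \<in> topspace (X k)" using S_in[OF b(1)] .
  show fin: "finite (carrier (D k))"
    using bij_betw_finite[OF deck_bij_fibre[OF bk]] finite_fibre[OF y, of k] S_proj[OF b(1), of 0 k] b(2)
    by simp
  have ev: "{h \<in> carrier G. h k = e} \<in> sets H" for e
    using component_event[of k "{e}"] by simp
  (* Two threads through \<open>e b\<^sub>k\<close> and \<open>d b\<^sub>k\<close> lie over the same point, and a group element carrying the
     first to the second translates the event \<open>h\<^sub>k = e\<close> into \<open>h\<^sub>k = d\<close>. *)
  have le: "measure H {h \<in> carrier G. h k = e} \<le> measure H {h \<in> carrier G. h k = d}"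
    if e: "e \<in> carrier (D k)" and d: "d \<in> carrier (D k)" for d e
  proof -
    obtain u where u: "u \<in> S" "u k = e ?bk"
      using thread_through[OF deck_group_in_topspace[OF e bk]] by blast
    obtain v where v: "v \<in> S" "v k = d ?bk"
      using thread_through[OF deck_group_in_topspace[OF d bk]] by blast
    have "u 0 = v 0"
      using S_proj[OF u(1), of 0 k] S_proj[OF v(1), of 0 k] u v
        deck_group_proj[OF e bk] deck_group_proj[OF d bk] by simp
    then obtain a where a: "a \<in> carrier G" "\<And>i. a i (u i) = v i"
      using G_transitive[OF u(1) v(1)] by blast
    have comp: "compose (topspace (X k)) (a k) e = d"
      using bk a(2)[of k] u(2) v(2)
      by (intro deck_group_eqI[OF sheets[of 0 k] conn deck_group_compose[OF G_component[OF a(1)] e] d bk])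
         (simp_all add: compose_def)
    have "a <#\<^bsub>G\<^esub> {h \<in> carrier G. h k = e} \<subseteq> {h \<in> carrier G. h k = d}"
      using G_closed[OF a(1)] G_mult[OF a(1)] comp by (auto simp: l_coset_def)
    then have "measure H (a <#\<^bsub>G\<^esub> {h \<in> carrier G. h k = e}) \<le> measure H {h \<in> carrier G. h k = d}"
      using ev by (intro finite_measure_mono)
    then show ?thesis
      using H_invariant[OF a(1) ev[of e]] by (simp add: measure_def)
  qed
  have "(\<Sum>e\<in>carrier (D k). measure H {h \<in> carrier G. h k = e}) = measure H (\<Union>e\<in>carrier (D k). {h \<in> carrier G. h k = e})"
    using ev fin by (intro finite_measure_finite_Union[symmetric]) (auto simp: disjoint_family_on_def)
  also have "(\<Union>e\<in>carrier (D k). {h \<in> carrier G. h k = e}) = space H"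
    using G_component by (auto simp: space_H)
  also have "measure H (space H) = 1" by (rule prob_space)
  \<comment> \<open>\<open>le\<close> holds for every ordered pair, so the two one-sided inclusions
    of events force equal masses.\<close>
  also have "(\<Sum>e\<in>carrier (D k). measure H {h \<in> carrier G. h k = e})
      = (\<Sum>e\<in>carrier (D k). measure H {h \<in> carrier G. h k = d})"
    using le d by (intro sum.cong refl antisym) auto
  finally have "real (order (D k)) * measure H {h \<in> carrier G. h k = d} = 1"
    by (simp add: order_def)
  then show "measure H {h \<in> carrier G. h k = d} = 1 / real (order (D k))"
    by (cases "order (D k) = 0") (simp_all add: field_simps)
qed

text \<open>This is the push-forward statement for a single fibre. Whether an orbit point lies in
  the cylinder depends only on the component \<open>h k\<close>; each admissible component has mass
  1/order, and by simple transitivity the admissible ones correspond to the points of E in the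
  fibre.\<close>

lemma fibre_measure_cylinder:
  assumes x: "x \<in> topspace (X 0)" and E: "E \<in> sets (borel_on (X k))"
  shows "emeasure (fibre_measure X p H x) ({z \<in> S. z k \<in> E} \<inter> solenoid_fibre X p x)
     = ennreal (real (card (E \<inter> fibre (X k) (tower_map p k 0) x)) / real (order (D k)))"
proof -
  let ?F = "solenoid_fibre X p x"
  let ?T = "subtopology (solenoid X p) ?F"
  \<comment> \<open>The same choice term as in \<open>fibre_measure\<close>, so unfolding that
    definition exposes the orbit map of this \<open>b\<close>.\<close>
  define b where "b = (SOME b. b \<in> ?F)"
  have "\<exists>b. b \<in> ?F"
    using thread_through[OF x] by (auto simp: solenoid_fibre_def fibre_def)
  then have b: "b \<in> ?F" unfolding b_def by (rule someI_ex)
  then have bS: "b \<in> S" "b 0 = x" by (auto simp: solenoid_fibre_def fibre_def)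
  have bk: "b k \<in> topspace (X k)" using S_in[OF bS(1)] .
  have orbit: "(\<lambda>h i. h i (b i)) \<in> measurable H (borel_on ?T)"
    using continuous_map_measurable_borel_on[OF orbit_continuous[OF b]]
    by (simp cong: measurable_cong_sets add: sets_H)
  have top: "topspace ?T = ?F"
    by (auto simp: solenoid_fibre_def fibre_def)
  have cyl: "{z \<in> S. z k \<in> E} \<inter> ?F \<in> sets (borel_on ?T)"
  proof -
    have "continuous_map ?T (X k) (\<lambda>z. z k)"
      by (intro continuous_map_from_subtopology continuous_map_level)
    from measurable_sets[OF continuous_map_measurable_borel_on[OF this] E]
    have "(\<lambda>z. z k) -` E \<inter> ?F \<in> sets (borel_on ?T)" by (simp only: space_borel_on top)
    moreover have "(\<lambda>z. z k) -` E \<inter> ?F = {z \<in> S. z k \<in> E} \<inter> ?F"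
      by (auto simp: solenoid_fibre_def fibre_def)
    ultimately show ?thesis by simp
  qed
  have "emeasure (fibre_measure X p H x) ({z \<in> S. z k \<in> E} \<inter> ?F)
      = emeasure H ((\<lambda>h i. h i (b i)) -` ({z \<in> S. z k \<in> E} \<inter> ?F) \<inter> space H)"
    unfolding fibre_measure_def b_def[symmetric] Let_def by (rule emeasure_distr[OF orbit cyl])
  also have "(\<lambda>h i. h i (b i)) -` ({z \<in> S. z k \<in> E} \<inter> ?F) \<inter> space H = {h \<in> carrier G. h k (b k) \<in> E}"
    (is "?L = ?R")
  proof -
    have "h \<in> ?L \<longleftrightarrow> h \<in> ?R" if h: "h \<in> carrier G" for h
      using h G_action[OF h bS(1)] bS(2) by (simp add: space_H solenoid_fibre_def fibre_def)
    then show ?thesis by (auto simp: space_H)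
  qed
  also have "\<dots> = (\<Union>d\<in>{d \<in> carrier (D k). d (b k) \<in> E}. {h \<in> carrier G. h k = d})"
    using G_component by auto
  also have "emeasure H \<dots> = ennreal (measure H (\<Union>d\<in>{d \<in> carrier (D k). d (b k) \<in> E}. {h \<in> carrier G. h k = d}))"
    by (rule emeasure_eq_measure)
  also have "measure H (\<Union>d\<in>{d \<in> carrier (D k). d (b k) \<in> E}. {h \<in> carrier G. h k = d})
      = (\<Sum>d\<in>{d \<in> carrier (D k). d (b k) \<in> E}. measure H {h \<in> carrier G. h k = d})"
  proof (rule finite_measure_finite_Union)
    \<comment> \<open>\<open>component_measure\<close> expects an element of the deck group, so the
      empty carrier is split off.\<close>
    show "finite {d \<in> carrier (D k). d (b k) \<in> E}"
      using component_measure(2)[OF x] by (cases "carrier (D k) = {}") auto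
    show "(\<lambda>d. {h \<in> carrier G. h k = d}) ` {d \<in> carrier (D k). d (b k) \<in> E} \<subseteq> events"
      using component_event[of k "{_}"] by auto
  qed (auto simp: disjoint_family_on_def)
  also have "\<dots> = real (card {d \<in> carrier (D k). d (b k) \<in> E}) / real (order (D k))"
    using component_measure(1)[OF x] by simp
  also have "card {d \<in> carrier (D k). d (b k) \<in> E} = card (E \<inter> fibre (X k) (tower_map p k 0) x)"
  proof (rule bij_betw_same_card)
    have "bij_betw (\<lambda>d. d (b k)) (carrier (D k)) (fibre (X k) (tower_map p k 0) x)"
      using deck_bij_fibre[OF bk] S_proj[OF bS(1), of 0 k] bS(2) by simp
    then show "bij_betw (\<lambda>d. d (b k)) {d \<in> carrier (D k). d (b k) \<in> E} (E \<inter> fibre (X k) (tower_map p k 0) x)"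
      by (auto simp: bij_betw_def inj_on_def)
  qed
  finally show ?thesis .
qed

end

section \<open>The measure of the solenoid and density in its L^2 space\<close>

locale solenoid_L2 = haar_tower X p H
  for X :: "nat \<Rightarrow> 'a topology" and p :: "nat \<Rightarrow> 'a \<Rightarrow> 'a" and H :: "(nat \<Rightarrow> 'a \<Rightarrow> 'a) measure" +
  fixes \<mu> :: "'a measure"
  assumes finite_base: "finite_measure \<mu>" and space_base: "space \<mu> = topspace (X 0)"
begin

abbreviation "\<mu>lim \<equiv> solenoid_measure X p \<mu> H"

abbreviation disintegration :: "(nat \<Rightarrow> 'a) set \<Rightarrow> ennreal" where
  "disintegration Z \<equiv> \<integral>\<^sup>+x. emeasure (fibre_measure X p H x) (Z \<inter> solenoid_fibre X p x) \<partial>\<mu>"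

lemma space_solenoid_measure: "space \<mu>lim = S"
  unfolding solenoid_measure_def by (rule space_measure_of[OF sets_borel_on_closed])

lemma sets_solenoid_measure: "sets \<mu>lim = sets (borel_on (solenoid X p))"
  unfolding solenoid_measure_def by (simp add: sets_measure_of[OF sets_borel_on_closed] sigma_sets_borel_on)

text \<open>\<^const>\<open>measure_of\<close> yields the zero measure unless the set function is countably additive.
  Countable additivity, which amounts to measurability in the base point, is never proved: the
  density theorem is trivial for the zero measure.\<close>

lemma emeasure_solenoid_measure:
  "emeasure \<mu>lim Z = (if Z \<in> sets (borel_on (solenoid X p)) \<and>
     measure_space S (sets (borel_on (solenoid X p))) disintegration then disintegration Z else 0)"
  unfolding solenoid_measure_def
  by (simp only: emeasure_measure_of_conv sigma_sets_borel_on)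

lemma level_measurable_solenoid_measure: "(\<lambda>x. x k) \<in> measurable \<mu>lim (borel_on (X k))"
  using level_measurable by (simp cong: measurable_cong_sets add: sets_solenoid_measure)

text \<open>The set function defining \<open>level_measure\<close> agrees on Borel sets with the
  push-forward. The latter is a genuine measure, so \<open>measure_of\<close> returns it: countable
  additivity on level k is inherited from the solenoid.\<close>

lemma distr_solenoid_measure:
  assumes ms: "measure_space S (sets (borel_on (solenoid X p))) disintegration"
  shows "distr \<mu>lim (borel_on (X k)) (\<lambda>x. x k) = level_measure X p \<mu> k"
proof -
  let ?Q = "distr \<mu>lim (borel_on (X k)) (\<lambda>x. x k)"
  have "measure_of (topspace (X k)) (sets (borel_on (X k))) (emeasure ?Q) = level_measure X p \<mu> k"
    unfolding level_measure_def
  proof (rule measure_of_eq[OF sets_borel_on_closed])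
    fix E assume "E \<in> sigma_sets (topspace (X k)) (sets (borel_on (X k)))"
    then have E: "E \<in> sets (borel_on (X k))" by (simp only: sigma_sets_borel_on)
    have pre: "(\<lambda>x. x k) -` E \<inter> space \<mu>lim = {z \<in> S. z k \<in> E}"
      by (auto simp: space_solenoid_measure)
    have "emeasure ?Q E = disintegration {z \<in> S. z k \<in> E}"
      using ms cylinder_measurable[OF E]
      by (simp add: emeasure_distr[OF level_measurable_solenoid_measure E] pre emeasure_solenoid_measure)
    also have "\<dots> = (\<integral>\<^sup>+x. ennreal (real (card (E \<inter> fibre (X k) (tower_map p k 0) x)) / real (order (D k))) \<partial>\<mu>)"
      by (intro nn_integral_cong fibre_measure_cylinder E) (simp add: space_base)
    finally show "emeasure ?Q E = \<dots>" .
  qed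
  moreover have "measure_of (topspace (X k)) (sets (borel_on (X k))) (emeasure ?Q) = ?Q"
    using measure_of_of_measure[of ?Q] by simp
  ultimately show ?thesis by simp
qed

lemma finite_measure_solenoid: "finite_measure \<mu>lim"
proof
  have "disintegration S \<le> (\<integral>\<^sup>+x. 1 \<partial>\<mu>)"
  proof (rule nn_integral_mono)
    fix x assume "x \<in> space \<mu>"
    then have x: "x \<in> topspace (X 0)" by (simp add: space_base)
    have "{z \<in> S. z 0 \<in> topspace (X 0)} = S" using S_in by auto
    moreover have "topspace (X 0) \<inter> fibre (X 0) (tower_map p 0 0) x = {x}"
      using x by (auto simp: fibre_def)
    ultimately have "emeasure (fibre_measure X p H x) (S \<inter> solenoid_fibre X p x) = ennreal (1 / real (order (D 0)))"
      using fibre_measure_cylinder[OF x openin_sets_borel_on[OF openin_topspace], of 0] by simp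
    \<comment> \<open>An upper bound suffices. If \<open>order (D 0)\<close> were 0, the quotient
      would be 1/0 = 0; a positive order gives a quotient of at most 1.\<close>
    also have "\<dots> \<le> 1"
      by (cases "order (D 0) = 0") (auto simp: ennreal_le_1 divide_le_eq)
    finally show "emeasure (fibre_measure X p H x) (S \<inter> solenoid_fibre X p x) \<le> 1" .
  qed
  also have "\<dots> < \<infinity>"
    using finite_measure.emeasure_finite[OF finite_base, of "space \<mu>"] by (simp add: less_top)
  finally show "emeasure \<mu>lim (space \<mu>lim) \<noteq> \<infinity>"
    by (auto simp: emeasure_solenoid_measure space_solenoid_measure)
qed

lemma solenoid_pullback_L2:
  assumes ms: "measure_space S (sets (borel_on (solenoid X p))) disintegration"
    and f: "f \<in> L2_space (level_measure X p \<mu> k)"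
  shows "(\<lambda>x. f (x k)) \<in> L2_space \<mu>lim"
    and "L2_norm \<mu>lim (\<lambda>x. f (x k)) = L2_norm (level_measure X p \<mu> k) f"
proof -
  note Q = distr_solenoid_measure[OF ms, of k, symmetric]
  have fm: "f \<in> borel_measurable (borel_on (X k))"
    and fi: "integrable (distr \<mu>lim (borel_on (X k)) (\<lambda>x. x k)) (\<lambda>x. (cmod (f x))\<^sup>2)"
    using f by (auto simp: L2_space_def Q)
  then have fm2: "(\<lambda>x. (cmod (f x))\<^sup>2) \<in> borel_measurable (borel_on (X k))" by measurable
  show "(\<lambda>x. f (x k)) \<in> L2_space \<mu>lim"
    using integrable_distr[OF level_measurable_solenoid_measure fi] measurable_compose[OF level_measurable_solenoid_measure fm]
    by (simp add: L2_space_def)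
  show "L2_norm \<mu>lim (\<lambda>x. f (x k)) = L2_norm (level_measure X p \<mu> k) f"
    unfolding L2_norm_def Q by (simp add: integral_distr[OF level_measurable_solenoid_measure fm2])
qed

lemma solenoid_pullback_span_dense:
  assumes dense: "\<And>k. L2_closure (level_measure X p \<mu> k) (complex_span (A k)) = L2_space (level_measure X p \<mu> k)"
  shows "L2_closure \<mu>lim (complex_span (\<Union>k. solenoid_pullback X p k ` A k)) = L2_space \<mu>lim"
    (is "L2_closure _ (complex_span ?B) = _")
proof (cases "measure_space S (sets (borel_on (solenoid X p))) disintegration")
  case False
  then show ?thesis
    by (intro L2_closure_span_null_measure) (simp add: emeasure_solenoid_measure)
next
  case ms: True
  show ?thesis
  proof (rule finite_measure.L2_closure_span_eq_L2_space[OF finite_measure_solenoid])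
    show "sets \<mu>lim = sigma_sets (space \<mu>lim) cylinders"
      by (simp add: sets_solenoid_measure space_solenoid_measure sets_borel_on_solenoid)
    show "cylinders \<subseteq> Pow (space \<mu>lim)" "space \<mu>lim \<in> cylinders"
      using S_in_cylinders by (auto simp: cylinders_def space_solenoid_measure)
    show "Int_stable cylinders" by (rule Int_stable_cylinders)
    fix C assume "C \<in> cylinders"
    then obtain k E where C: "C = {x \<in> S. x k \<in> E}" and E: "E \<in> sets (borel_on (X k))"
      unfolding cylinders_def by blast
    let ?\<nu> = "level_measure X p \<mu> k"
    have "finite_measure ?\<nu>"
      unfolding distr_solenoid_measure[OF ms, symmetric]
      by (rule finite_measure.finite_measure_distr[OF finite_measure_solenoid level_measurable_solenoid_measure])
    moreover have "E \<in> sets ?\<nu>"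
      using E by (simp add: distr_solenoid_measure[OF ms, symmetric])
    ultimately have indE: "indicator E \<in> L2_space ?\<nu>"
      by (rule finite_measure.indicator_in_L2_space)
    have "C \<in> sets \<mu>lim"
      unfolding C sets_solenoid_measure by (rule cylinder_measurable[OF E])
    then have indC: "indicator C \<in> L2_space \<mu>lim"
      by (rule finite_measure.indicator_in_L2_space[OF finite_measure_solenoid])
    show "indicator C \<in> L2_closure \<mu>lim (complex_span ?B)"
      unfolding L2_closure_def
    proof (intro CollectI conjI allI impI indC)
      fix \<epsilon> :: real assume "\<epsilon> > 0"
      moreover have "indicator E \<in> L2_closure ?\<nu> (complex_span (A k))"
        using indE by (simp only: dense)
      ultimately obtain h where h: "h \<in> complex_span (A k)" "h \<in> L2_space ?\<nu>"
        "L2_norm ?\<nu> (\<lambda>x. indicator E x - h x) < \<epsilon>"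
        unfolding L2_closure_def by blast
      obtain F a where F: "finite F" "F \<subseteq> A k" "h = (\<lambda>x. \<Sum>f\<in>F. a f * f x)"
        using h(1) by (auto simp: complex_span_def)
      \<comment> \<open>The pullbacks are extensional, so \<open>h'\<close> agrees with h evaluated
        at \<open>x k\<close> only on the solenoid. Membership and norm are therefore transferred by
        congruence on the space of the measure.\<close>
      define h' where "h' = (\<lambda>x. \<Sum>f\<in>F. a f * solenoid_pullback X p k f x)"
      have h'h: "h' x = h (x k)" if "x \<in> space \<mu>lim" for x
        using that by (simp add: h'_def F(3) space_solenoid_measure compose_def)
      have "h' \<in> complex_span ?B"
        unfolding h'_def using F(1,2) by (intro complex_span_sum) auto
      moreover have "h' \<in> L2_space \<mu>lim"
        using solenoid_pullback_L2(1)[OF ms h(2)] L2_space_cong[of "\<mu>lim" h' "\<lambda>x. h (x k)"] h'h by simp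
      moreover have "L2_norm \<mu>lim (\<lambda>x. indicator C x - h' x) = L2_norm \<mu>lim (\<lambda>x. indicator E (x k) - h (x k))"
        unfolding L2_norm_def
        by (intro arg_cong[where f = sqrt] Bochner_Integration.integral_cong refl)
           (simp add: h'h, simp add: C space_solenoid_measure indicator_def)
      moreover have "\<dots> = L2_norm ?\<nu> (\<lambda>x. indicator E x - h x)"
        by (rule solenoid_pullback_L2(2)[OF ms L2_space_diff[OF indE h(2)]])
      ultimately show "\<exists>h\<in>complex_span ?B \<inter> L2_space \<mu>lim. L2_norm \<mu>lim (\<lambda>x. indicator C x - h x) < \<epsilon>"
        using h(3) by (intro bexI[of _ h']) auto
    qed
  qed
qed

end

section \<open>The density theorem\<close>

theorem proposition4p1:
  fixes n :: nat
    and M :: "nat \<Rightarrow> 'a smooth_space"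
    and X :: "nat \<Rightarrow> 'a topology"
    and p :: "nat \<Rightarrow> 'a \<Rightarrow> 'a"
    and g :: "'a metric_tensor"
    and \<mu>\<^sub>1 :: "'a measure"
    and H :: "(nat \<Rightarrow> 'a \<Rightarrow> 'a) measure"
    and A :: "nat \<Rightarrow> ('a \<Rightarrow> complex) set"
  defines "X \<equiv> \<lambda>k. mtop (M k)"
  assumes manifold: "\<And>k. smooth_manifold n (M k)"
    and connected: "\<And>k. connected_space (X k)"
    and covering: "\<And>i j. i < j \<Longrightarrow> regular_finite_covering n (M j) (M i) (tower_map p j i)"
    and closed: "compact_space (X 0)"
    and metric: "riemannian_metric n (M 0) g"
    and volume: "riemannian_volume n (M 0) g \<mu>\<^sub>1"
    and haar: "haar_probability (solenoid_group X p) (solenoid_group_topology X p) H"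
    and eigen: "\<And>k f. f \<in> A k \<Longrightarrow>
          laplace_eigenfunction n (M k) (pullback_metric n (M 0) (tower_map p k 0) g) f"
    and orthonormal: "\<And>k. orthonormal_in (level_measure X p \<mu>\<^sub>1 k) (A k)"
    and dense: "\<And>k. L2_closure (level_measure X p \<mu>\<^sub>1 k) (complex_span (A k))
          = L2_space (level_measure X p \<mu>\<^sub>1 k)"
    and pullback: "\<And>k. level_pullback X p k ` A k \<subseteq> A (Suc k)"
  shows "L2_closure (solenoid_measure X p \<mu>\<^sub>1 H)
           (complex_span (\<Union>k. solenoid_pullback X p k ` A k))
         = L2_space (solenoid_measure X p \<mu>\<^sub>1 H)"
proof -
  interpret covering_tower X p
  proof
    show "connected_space (X k)" for k by (rule connected)
    show "sheeted (X j) (X i) (tower_map p j i)" if "i \<le> j" for i j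
      using covering[of i j] that
      by (cases "i = j") (auto simp: X_def regular_finite_covering_def sheeted_id intro: smooth_covering_sheeted)
    show "finite (fibre (X j) (tower_map p j 0) y)" if "y \<in> topspace (X 0)" for j y
    proof (cases "j = 0")
      case True
      have "fibre (X 0) id y \<subseteq> {y}" by (auto simp: fibre_def)
      then show ?thesis using True by (simp add: finite_subset)
    next
      case False
      then show ?thesis
        using covering[of 0 j] that by (simp add: X_def regular_finite_covering_def)
    qed
    show "\<exists>h\<in>carrier (level_deck_group X p j). h x = x'"
      if "x \<in> topspace (X j)" "x' \<in> topspace (X j)" "tower_map p j 0 x = tower_map p j 0 x'" for j x x'
    proof (cases "j = 0")
      case True
      \<comment> \<open>The identity has to be restricted to the space, since members of
        \<open>Bij\<close> are extensional.\<close>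
      have "(\<lambda>y\<in>topspace (X 0). y) \<in> carrier (level_deck_group X p 0)"
        unfolding deck_group_carrier
        by (auto simp: id_Bij intro: homeomorphic_map_eq[OF homeomorphic_map_id[THEN iffD2]])
      then show ?thesis
        using True that by (intro bexI[of _ "\<lambda>y\<in>topspace (X 0). y"]) auto
    next
      case False
      then show ?thesis
        using covering[of 0 j] that by (simp add: X_def regular_finite_covering_def)
    qed
  qed
  interpret haar_tower X p H
    by unfold_locales (rule haar)
  interpret solenoid_L2 X p H \<mu>\<^sub>1
  proof (rule solenoid_L2.intro[OF haar_tower_axioms], rule solenoid_L2_axioms.intro)
    show "finite_measure \<mu>\<^sub>1"
      using riemannian_volume_finite[OF manifold metric volume] closed by (simp add: X_def)
    show "space \<mu>\<^sub>1 = topspace (X 0)"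
      using volume by (simp add: riemannian_volume_def X_def)
  qed
  show ?thesis
    by (rule solenoid_pullback_span_dense[OF dense])
qed

end
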